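(* Assume that (i) there exists $(n_1,\dots,n_p)\in(\mathbb{N}\setminus\{0\})^p$ such that $\mathbb{P}(|f(G,(n_1,\dots,n_p))|>0)>0$; (ii) there exists $\gamma>0$ such that $\mathbb{E}[|f(G,N^\mu)|^{2+\gamma}]<\infty$. Then the function $v:\mathbb{R}^d\times(0,\infty)^p\to\mathbb{R}$ defined by $$v(\theta,\lambda)=\mathbb{E}[F(G,\theta,N^\mu,\lambda)]$$ is infinitely continuously differentiable and strongly convex. Moreover its gradients are given by $$\nabla_\theta v(\theta,\lambda)=\mathbb{E}[(\theta-G)\,F(G,\theta,N^\mu,\lambda)],\qquad \nabla_\lambda v(\theta,\lambda)=\mathbb{E}[a(N^\mu,\lambda)\,F(G,\theta,N^\mu,\lambda)],$$ and its second derivatives are given by $$\nabla^2_{\theta,\theta}v(\theta,\lambda)=\mathbb{E}\left[\left(I_d+(\theta-G)(\theta-G)^*\right)F(G,\theta,N^\mu,\lambda)\right],$$ $$\nabla^2_{\theta,\lambda}v(\theta,\lambda)=\mathbb{E}\left[(\theta-G)\,a(N^\mu,\lambda)^*\,F(G,\theta,N^\mu,\lambda)\right],$$ $$\nabla^2_{\lambda,\lambda}v(\theta,\lambda)=\mathbb{E}\left[\left(D+a(N^\mu,\lambda)\,a(N^\mu,\lambda)^*\right)F(G,\theta,N^\mu,\lambda)\right].$$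
   Context: $\mathbb{N}=\{0,1,2,\dots\}$. $G$ is a standard normal random vector in $\mathbb{R}^d$; $\mu=(\mu_1,\dots,\mu_p)\in(0,\infty)^p$ is fixed; $N^\mu=(N_1^{\mu_1},\dots,N_p^{\mu_p})$ is a vector of independent Poisson random variables with parameters $\mu_1,\dots,\mu_p$, independent of $G$. $f:\mathbb{R}^d\times\mathbb{N}^p\to\mathbb{R}$ is measurable with $\mathbb{E}[|f(G,N^\mu)|]<\infty$. For $g\in\mathbb{R}^d$, $\theta\in\mathbb{R}^d$, $n\in\mathbb{N}^p$, $\lambda\in(0,\infty)^p$, $$F(g,\theta,n,\lambda)=f(g,n)^2\,e^{-\theta\cdot g+\frac{|\theta|^2}{2}}\prod_{i=1}^p e^{\lambda_i-\mu_i}\left(\frac{\mu_i}{\lambda_i}\right)^{n_i}.$$ Vectors are column vectors, ${}^*$ denotes the transpose, and $I_d$ is the $d\times d$ identity matrix. $a(N^\mu,\lambda)=\left(1-\frac{N_1^{\mu_1}}{\lambda_1},\dots,1-\frac{N_p^{\mu_p}}{\lambda_p}\right)^*$, and $D$ is the $p\times p$ diagonal matrix with diagonal entries $\frac{N_1^{\mu_1}}{\lambda_1^2},\dots,\frac{N_p^{\mu_p}}{\lambda_p^2}$. Strongly convex means that the Hessian is bounded below, uniformly on the domain, by $c$ times the identity for some $c>0$. *)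

theory Defs
  imports "HOL-Probability.Probability"
begin

definition gradient :: "('a::real_inner \<Rightarrow> real) \<Rightarrow> 'a \<Rightarrow> 'a" where
  "gradient f x = (THE D. GDERIV f x :> D)"

text \<open>
  In finite dimension, \<open>C\<^sup>k\<close> on an open set means: all iterated directional derivatives of
  order at most \<open>k\<close> exist and are continuous.
\<close>

primrec Ck_on :: "nat \<Rightarrow> ('a::euclidean_space \<Rightarrow> real) \<Rightarrow> 'a set \<Rightarrow> bool" where
  "Ck_on 0 f S \<longleftrightarrow> continuous_on S f"
| "Ck_on (Suc k) f S \<longleftrightarrow>
     (\<forall>x\<in>S. f differentiable (at x)) \<and>
     (\<forall>h. Ck_on k (\<lambda>x. frechet_derivative f (at x) h) S)"

definition smooth_on :: "('a::euclidean_space \<Rightarrow> real) \<Rightarrow> 'a set \<Rightarrow> bool" where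
  "smooth_on f S \<longleftrightarrow> open S \<and> (\<forall>k. Ck_on k f S)"

text \<open>
  The Hessian at \<open>x\<close> is the linear map \<open>H\<close>, the derivative of the gradient; its lower bound
  by \<open>c\<close> times the identity is in the sense of quadratic forms.
\<close>

definition strongly_convex_on :: "('a::euclidean_space \<Rightarrow> real) \<Rightarrow> 'a set \<Rightarrow> bool" where
  "strongly_convex_on f S \<longleftrightarrow>
     open S \<and> convex S \<and> (\<forall>x\<in>S. f differentiable (at x)) \<and>
     (\<exists>c>0. \<forall>x\<in>S. \<exists>H. (gradient f has_derivative H) (at x) \<and>
        (\<forall>h. c * (h \<bullet> h) \<le> H h \<bullet> h))"

definition outer :: "real ^ 'm \<Rightarrow> real ^ 'n \<Rightarrow> real ^ 'n ^ 'm" where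
  "outer x y = (\<chi> i j. x $ i * y $ j)"

definition (in prob_space) std_normal_vector :: "('a \<Rightarrow> real ^ 'd) \<Rightarrow> bool" where
  "std_normal_vector G \<longleftrightarrow>
     indep_vars (\<lambda>_. borel) (\<lambda>i \<omega>. G \<omega> $ i) UNIV \<and>
     (\<forall>i. distributed M lborel (\<lambda>\<omega>. G \<omega> $ i) std_normal_density)"

definition (in prob_space) poisson_vector :: "real ^ 'p \<Rightarrow> ('a \<Rightarrow> nat ^ 'p) \<Rightarrow> bool" where
  "poisson_vector \<mu> N \<longleftrightarrow>
     indep_vars (\<lambda>_. count_space UNIV) (\<lambda>i \<omega>. N \<omega> $ i) UNIV \<and>
     (\<forall>i. distr M (count_space UNIV) (\<lambda>\<omega>. N \<omega> $ i) = measure_pmf (poisson_pmf (\<mu> $ i)))"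

text \<open>
  The library's \<open>indep_var\<close> requires both variables to have the same type, hence independence of
  the generated sigma-algebras is spelled out.
\<close>

definition (in prob_space) indep_rv ::
  "'b measure \<Rightarrow> ('a \<Rightarrow> 'b) \<Rightarrow> 'c measure \<Rightarrow> ('a \<Rightarrow> 'c) \<Rightarrow> bool" where
  "indep_rv A X B Y \<longleftrightarrow>
     random_variable A X \<and> random_variable B Y \<and>
     indep_set (sets (vimage_algebra (space M) X A)) (sets (vimage_algebra (space M) Y B))"

definition F_fun ::
  "(real ^ 'd \<Rightarrow> nat ^ 'p \<Rightarrow> real) \<Rightarrow> real ^ 'p \<Rightarrow>
   real ^ 'd \<Rightarrow> real ^ 'd \<Rightarrow> nat ^ 'p \<Rightarrow> real ^ 'p \<Rightarrow> real" where
  "F_fun f \<mu> g \<theta> n lam =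
     (f g n)\<^sup>2 * exp (- (\<theta> \<bullet> g) + (norm \<theta>)\<^sup>2 / 2) *
     (\<Prod>i\<in>UNIV. exp (lam $ i - \<mu> $ i) * (\<mu> $ i / lam $ i) ^ (n $ i))"

definition a_vec :: "nat ^ 'p \<Rightarrow> real ^ 'p \<Rightarrow> real ^ 'p" where
  "a_vec n lam = (\<chi> i. 1 - real (n $ i) / lam $ i)"

definition D_mat :: "nat ^ 'p \<Rightarrow> real ^ 'p \<Rightarrow> real ^ 'p ^ 'p" where
  "D_mat n lam = (\<chi> i j. if i = j then real (n $ i) / (lam $ i)\<^sup>2 else 0)"

definition (in prob_space) v_fun ::
  "('a \<Rightarrow> real ^ 'd) \<Rightarrow> ('a \<Rightarrow> nat ^ 'p) \<Rightarrow> (real ^ 'd \<Rightarrow> nat ^ 'p \<Rightarrow> real) \<Rightarrow> real ^ 'p \<Rightarrow>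
   (real ^ 'd) \<times> (real ^ 'p) \<Rightarrow> real" where
  "v_fun G N f \<mu> = (\<lambda>(\<theta>, lam). expectation (\<lambda>\<omega>. F_fun f \<mu> (G \<omega>) \<theta> (N \<omega>) lam))"

text \<open>
  The values of \<open>v_fun\<close> outside this open set are junk; they do not affect derivatives inside it.
\<close>

definition dom_v :: "((real ^ 'd) \<times> (real ^ 'p)) set" where
  "dom_v = UNIV \<times> {lam. \<forall>i. 0 < lam $ i}"

end

theory Submission
  imports Defs
begin

text \<open>
  Write \<open>W = f(G,N)\<^sup>2\<close> and \<open>Z = (G,N)\<close>, a random vector in \<open>\<real>\<^sup>d \<times> \<real>\<^sup>p\<close>. The factor \<open>tilt (\<theta>,\<lambda>)\<close> by
  which \<open>F\<close> multiplies \<open>W\<close> is a likelihood ratio of an exponential family: it equals an elementary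
  function of \<open>(\<theta>,\<lambda>)\<close> times \<open>exp (u \<bullet> Z)\<close> with \<open>u = (- \<theta>, ln \<mu> - ln \<lambda>)\<close>. So \<open>v\<close> is, up to this
  elementary factor and this change of variables, the Laplace transform \<open>u \<mapsto> E[W exp (u \<bullet> Z)]\<close>.

  The moment assumption on \<open>f(G,N)\<close> makes this transform finite everywhere. Gaussian and Poisson variables have all
  exponential moments, and Young's inequality \<open>y\<^sup>2 E \<le> \<bar>y\<bar>\<^bsup>2+\<gamma>\<^esup> + E\<^bsup>(2+\<gamma>)/\<gamma>\<^esup>\<close> gives
  \<open>E[W exp (c \<bar>Z\<bar>)] < \<infinity>\<close> for all \<open>c\<close>. A weight \<open>W\<close> with this
  property is called \<open>exp_integrable\<close>, and the property survives multiplication by any random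
  variable of at most exponential growth in \<open>\<bar>Z\<bar>\<close>. Then \<open>\<bar>exp t - 1 - t\<bar> \<le> t\<^sup>2 exp \<bar>t\<bar>\<close> bounds the
  Taylor remainder of the transform by a multiple of \<open>\<bar>h\<bar>\<^sup>2\<close>, which yields its derivative
  (\<open>has_derivative_Laplace_transform\<close>).

  Translated back, \<open>J W x = E[W tilt x]\<close> (the constant \<open>tilted_mean\<close>) has derivative
  \<open>h \<mapsto> J (W (score x \<bullet> h)) x\<close> with \<open>score (\<theta>,\<lambda>) = (\<theta> - G, a(N,\<lambda>))\<close>. The score is affine in \<open>Z\<close>
  with coefficients that are smooth in \<open>x\<close>. So the derivative is a combination, with smooth
  coefficients, of \<open>J\<close> at the new weights \<open>W\<close>, \<open>W (h\<^sub>1 \<bullet> G)\<close> and \<open>W N\<^sub>i\<close> (\<open>tilted_mean_score\<close>), which are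
  again \<open>exp_integrable\<close>. This gives smoothness by induction on the order, for all weights at
  once, and differentiating the combination once more gives the Hessian
  \<open>E[W tilt (score' + score score\<^sup>*)]\<close>, whose blocks are those of the theorem.

  For strong convexity, the rank one part is dropped and the expectation is restricted to the event
  \<open>N = n\<close>, where \<open>n\<close> has no zero entry and \<open>f(G,n)\<close> is not
  almost surely zero. There, \<open>- \<theta> \<bullet> g + \<bar>\<theta>\<bar>\<^sup>2 / 2 \<ge> - \<bar>g\<bar>\<^sup>2 / 2\<close> removes \<open>\<theta>\<close>, and
  \<open>exp \<lambda>\<^sub>i / \<lambda>\<^sub>i\<^bsup>k\<^esup> \<ge> 1 / k!\<close> removes \<open>\<lambda>\<close>: it is used with \<open>k = n\<^sub>i\<close>, and with \<open>k = n\<^sub>i + 2\<close> for the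
  direction \<open>\<lambda>\<^sub>i\<close>, whose factor \<open>n\<^sub>i / \<lambda>\<^sub>i\<^sup>2\<close> is nonzero because \<open>n\<^sub>i \<noteq> 0\<close>
  (\<open>tilt_hessian_lower_bound\<close>). What remains is a constant times
  \<open>E[W exp (- \<bar>G\<bar>\<^sup>2 / 2); N = n]\<close>, which is positive by independence.
\<close>

section \<open>Calculus of iterated differentiability\<close>

lemma Ck_on_cong:
  assumes "open S"
  shows "Ck_on k f S \<Longrightarrow> (\<And>x. x \<in> S \<Longrightarrow> f x = g x) \<Longrightarrow> Ck_on k g S"
proof (induction k arbitrary: f g)
  case 0
  then show ?case using continuous_on_cong[of S S f g] by simp
next
  case (Suc k)
  have fd: "f differentiable (at x)" if "x \<in> S" for x
    using Suc.prems(1) that by simp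
  show ?case unfolding Ck_on.simps
  proof (intro conjI ballI allI)
    show "g differentiable (at x)" if x: "x \<in> S" for x
    proof -
      obtain D where "(f has_derivative D) (at x)"
        using fd[OF x] unfolding differentiable_def by blast
      from has_derivative_transform_within_open[OF this \<open>open S\<close> x Suc.prems(2)]
      show ?thesis unfolding differentiable_def by blast
    qed
    fix h
    have "Ck_on k (\<lambda>x. frechet_derivative f (at x) h) S"
      using Suc.prems(1) by simp
    moreover have "frechet_derivative f (at x) h = frechet_derivative g (at x) h" if "x \<in> S" for x
      by (rule fun_cong[OF frechet_derivative_transform_within_open[OF fd[OF that] \<open>open S\<close> that Suc.prems(2)]])
    ultimately show "Ck_on k (\<lambda>x. frechet_derivative g (at x) h) S"
      by (rule Suc.IH)
  qed
qed

text \<open>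
  The recursion defining \<open>Ck_on\<close> speaks of the derivative chosen by \<open>frechet_derivative\<close> at every
  point; this form accepts any family of derivatives on \<open>S\<close>, which is how they are computed below.
\<close>

lemma Ck_on_SucI:
  assumes "open S" "\<And>x. x \<in> S \<Longrightarrow> (f has_derivative f' x) (at x)"
    and "\<And>h. Ck_on k (\<lambda>x. f' x h) S"
  shows "Ck_on (Suc k) f S"
  unfolding Ck_on.simps
proof (intro conjI ballI allI)
  show "f differentiable (at x)" if "x \<in> S" for x
    using assms(2)[OF that] unfolding differentiable_def by blast
  fix h
  have "f' x h = frechet_derivative f (at x) h" if "x \<in> S" for x
    using frechet_derivative_at[OF assms(2)[OF that]] by (rule fun_cong)
  from Ck_on_cong[OF \<open>open S\<close> assms(3) this]
  show "Ck_on k (\<lambda>x. frechet_derivative f (at x) h) S" .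
qed

lemma Ck_on_SucD:
  assumes "Ck_on (Suc k) f S"
  shows "\<And>x. x \<in> S \<Longrightarrow> (f has_derivative frechet_derivative f (at x)) (at x)"
    and "\<And>h. Ck_on k (\<lambda>x. frechet_derivative f (at x) h) S"
  using assms unfolding Ck_on.simps frechet_derivative_works by blast+

lemma Ck_on_mono: "Ck_on (Suc k) f S \<Longrightarrow> Ck_on k f S"
proof (induction k arbitrary: f)
  case 0
  then show ?case
    by (auto intro!: continuous_at_imp_continuous_on differentiable_imp_continuous_within)
next
  case (Suc k)
  then show ?case by (metis Ck_on.simps(2))
qed

lemma Ck_on_const: "open S \<Longrightarrow> Ck_on k (\<lambda>x. c) S"
proof (induction k arbitrary: c)
  case (Suc k)
  show ?case by (rule Ck_on_SucI[where f' = "\<lambda>x h. 0"]) (use Suc in auto)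
qed auto

lemma Ck_on_bounded_linear:
  assumes "open S" "bounded_linear f"
  shows "Ck_on k f S"
proof (cases k)
  case 0
  then show ?thesis using assms by (simp add: linear_continuous_on)
next
  case (Suc j)
  show ?thesis unfolding Suc
    by (rule Ck_on_SucI[OF assms(1) bounded_linear_imp_has_derivative[OF assms(2)] Ck_on_const[OF assms(1)]])
qed

lemma Ck_on_add:
  assumes "open S"
  shows "Ck_on k f S \<Longrightarrow> Ck_on k g S \<Longrightarrow> Ck_on k (\<lambda>x. f x + g x) S"
proof (induction k arbitrary: f g)
  case 0
  then show ?case by (simp add: continuous_on_add)
next
  case (Suc k)
  note F = Ck_on_SucD[OF Suc.prems(1)] and G = Ck_on_SucD[OF Suc.prems(2)]
  show ?case
    by (rule Ck_on_SucI[OF assms has_derivative_add[OF F(1) G(1)] Suc.IH[OF F(2) G(2)]])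
qed

lemma Ck_on_mult:
  assumes "open S"
  shows "Ck_on k f S \<Longrightarrow> Ck_on k g S \<Longrightarrow> Ck_on k (\<lambda>x. f x * g x) S"
proof (induction k arbitrary: f g)
  case 0
  then show ?case by (simp add: continuous_on_mult)
next
  case (Suc k)
  note F = Ck_on_SucD[OF Suc.prems(1)] and G = Ck_on_SucD[OF Suc.prems(2)]
  show ?case
    by (rule Ck_on_SucI[OF assms has_derivative_mult[OF F(1) G(1)]
          Ck_on_add[OF assms Suc.IH[OF Ck_on_mono[OF Suc.prems(1)] G(2)]
            Suc.IH[OF F(2) Ck_on_mono[OF Suc.prems(2)]]]])
qed

lemma Ck_on_diff:
  assumes "open S" "Ck_on k f S" "Ck_on k g S"
  shows "Ck_on k (\<lambda>x. f x - g x) S"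
  using Ck_on_add[OF assms(1,2) Ck_on_mult[OF assms(1) Ck_on_const[OF assms(1), of _ "-1"] assms(3)]]
  by simp

lemma Ck_on_sum:
  assumes "open S" "finite I" "\<And>i. i \<in> I \<Longrightarrow> Ck_on k (f i) S"
  shows "Ck_on k (\<lambda>x. \<Sum>i\<in>I. f i x) S"
  using assms(2,3)
proof (induction I rule: finite_induct)
  case empty
  show ?case using Ck_on_const[OF assms(1)] by simp
next
  case (insert i I)
  then show ?case using Ck_on_add[OF assms(1), of k "f i" "\<lambda>x. \<Sum>i\<in>I. f i x"] by simp
qed

lemma Ck_on_inverse:
  fixes f :: "'a::euclidean_space \<Rightarrow> real"
  assumes "open S" "\<And>x. x \<in> S \<Longrightarrow> f x \<noteq> 0"
  shows "Ck_on k f S \<Longrightarrow> Ck_on k (\<lambda>x. inverse (f x)) S"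
proof (induction k)
  case 0
  then show ?case using assms(2) by (simp add: continuous_on_inverse)
next
  case (Suc k)
  note F = Ck_on_SucD[OF Suc.prems]
  have "Ck_on k (\<lambda>x. - 1 * (inverse (f x) * frechet_derivative f (at x) h * inverse (f x))) S" for h
    by (intro Ck_on_mult Ck_on_const assms(1) Suc.IH Ck_on_mono[OF Suc.prems] F(2))
  then show ?case
    by (intro Ck_on_SucI[OF assms(1) Deriv.has_derivative_inverse[OF assms(2) F(1)]]) simp_all
qed

section \<open>Exponential growth and exponential integrability\<close>

text \<open>
  Growth is measured against a fixed random vector \<open>Z\<close>. Measurability is part of the notion, so that
  its closure properties alone yield integrability.
\<close>

definition exp_growth ::
  "'w measure \<Rightarrow> ('w \<Rightarrow> 'z::real_normed_vector) \<Rightarrow> ('w \<Rightarrow> 'b::real_normed_vector) \<Rightarrow> bool" where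
  "exp_growth M Z Y \<longleftrightarrow> Y \<in> borel_measurable M \<and>
     (\<exists>C c. \<forall>\<omega>. norm (Y \<omega>) \<le> C * exp (c * norm (Z \<omega>)))"

definition exp_integrable :: "'w measure \<Rightarrow> ('w \<Rightarrow> 'z::real_normed_vector) \<Rightarrow> ('w \<Rightarrow> real) \<Rightarrow> bool" where
  "exp_integrable M Z W \<longleftrightarrow> W \<in> borel_measurable M \<and>
     (\<forall>c. integrable M (\<lambda>\<omega>. W \<omega> * exp (c * norm (Z \<omega>))))"

lemma exp_growthI:
  assumes "Y \<in> borel_measurable M" "\<And>\<omega>. norm (Y \<omega>) \<le> C * exp (c * norm (Z \<omega>))"
  shows "exp_growth M Z Y"
  using assms unfolding exp_growth_def by auto

lemma exp_growth_measurable: "exp_growth M Z Y \<Longrightarrow> Y \<in> borel_measurable M"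
  by (simp add: exp_growth_def)

lemma exp_growthE:
  assumes "exp_growth M Z Y"
  obtains C c where "0 \<le> C" "0 \<le> c" "\<And>\<omega>. norm (Y \<omega>) \<le> C * exp (c * norm (Z \<omega>))"
proof -
  from assms obtain C c where b: "\<And>\<omega>. norm (Y \<omega>) \<le> C * exp (c * norm (Z \<omega>))"
    unfolding exp_growth_def by auto
  have "norm (Y \<omega>) \<le> \<bar>C\<bar> * exp (\<bar>c\<bar> * norm (Z \<omega>))" for \<omega>
    by (rule order.trans[OF b]) (auto intro!: mult_mono mult_right_mono)
  then show thesis using that[of "\<bar>C\<bar>" "\<bar>c\<bar>"] by simp
qed

lemma exp_growth_const [intro]: "exp_growth M Z (\<lambda>_. c)"
  by (rule exp_growthI[of _ _ "norm c" 0]) auto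

lemma exp_growth_add [intro]:
  fixes X Y :: "'w \<Rightarrow> 'b::euclidean_space"
  assumes "exp_growth M Z X" "exp_growth M Z Y"
  shows "exp_growth M Z (\<lambda>\<omega>. X \<omega> + Y \<omega>)"
proof -
  obtain C c where X: "0 \<le> C" "0 \<le> c" "\<And>\<omega>. norm (X \<omega>) \<le> C * exp (c * norm (Z \<omega>))"
    using exp_growthE[OF assms(1)] by blast
  obtain D d where Y: "0 \<le> D" "0 \<le> d" "\<And>\<omega>. norm (Y \<omega>) \<le> D * exp (d * norm (Z \<omega>))"
    using exp_growthE[OF assms(2)] by blast
  have "norm (X \<omega> + Y \<omega>) \<le> (C + D) * exp ((c + d) * norm (Z \<omega>))" for \<omega>
  proof -
    have "norm (X \<omega> + Y \<omega>) \<le> C * exp (c * norm (Z \<omega>)) + D * exp (d * norm (Z \<omega>))"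
      using norm_triangle_ineq[of "X \<omega>" "Y \<omega>"] X(3)[of \<omega>] Y(3)[of \<omega>] by linarith
    also have "\<dots> \<le> C * exp ((c + d) * norm (Z \<omega>)) + D * exp ((c + d) * norm (Z \<omega>))"
      using X(1,2) Y(1,2) by (intro add_mono mult_left_mono) (auto intro: mult_right_mono)
    finally show ?thesis by (simp add: algebra_simps)
  qed
  moreover have "(\<lambda>\<omega>. X \<omega> + Y \<omega>) \<in> borel_measurable M"
    using assms by (auto simp: exp_growth_def)
  ultimately show ?thesis by (intro exp_growthI)
qed

lemma exp_growth_scaleR [intro]:
  fixes Y :: "'w \<Rightarrow> 'b::euclidean_space"
  assumes "exp_growth M Z X" "exp_growth M Z Y"
  shows "exp_growth M Z (\<lambda>\<omega>. X \<omega> *\<^sub>R Y \<omega>)"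
proof -
  obtain C c where X: "0 \<le> C" "0 \<le> c" "\<And>\<omega>. norm (X \<omega>) \<le> C * exp (c * norm (Z \<omega>))"
    using exp_growthE[OF assms(1)] by blast
  obtain D d where Y: "0 \<le> D" "0 \<le> d" "\<And>\<omega>. norm (Y \<omega>) \<le> D * exp (d * norm (Z \<omega>))"
    using exp_growthE[OF assms(2)] by blast
  have "norm (X \<omega> *\<^sub>R Y \<omega>) \<le> (C * D) * exp ((c + d) * norm (Z \<omega>))" for \<omega>
  proof -
    have "norm (X \<omega> *\<^sub>R Y \<omega>) = norm (X \<omega>) * norm (Y \<omega>)" by simp
    also have "\<dots> \<le> (C * exp (c * norm (Z \<omega>))) * (D * exp (d * norm (Z \<omega>)))"
      using X Y by (intro mult_mono) auto
    finally show ?thesis by (simp add: algebra_simps exp_add)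
  qed
  moreover have "(\<lambda>\<omega>. X \<omega> *\<^sub>R Y \<omega>) \<in> borel_measurable M"
    using assms by (auto simp: exp_growth_def)
  ultimately show ?thesis by (intro exp_growthI)
qed

lemma exp_growth_mult [intro]:
  fixes X Y :: "'w \<Rightarrow> real"
  shows "exp_growth M Z X \<Longrightarrow> exp_growth M Z Y \<Longrightarrow> exp_growth M Z (\<lambda>\<omega>. X \<omega> * Y \<omega>)"
  using exp_growth_scaleR[of M Z X Y] by simp

lemma exp_growth_diff [intro]:
  fixes X Y :: "'w \<Rightarrow> 'b::euclidean_space"
  assumes "exp_growth M Z X" "exp_growth M Z Y"
  shows "exp_growth M Z (\<lambda>\<omega>. X \<omega> - Y \<omega>)"
  using exp_growth_add[OF assms(1) exp_growth_scaleR[OF exp_growth_const[of M Z "-1"] assms(2)]]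
  by simp

lemma exp_growth_sum [intro]:
  fixes Y :: "'i \<Rightarrow> 'w \<Rightarrow> 'b::euclidean_space"
  assumes "\<And>i. i \<in> I \<Longrightarrow> exp_growth M Z (Y i)"
  shows "exp_growth M Z (\<lambda>\<omega>. \<Sum>i\<in>I. Y i \<omega>)"
  using assms by (induction I rule: infinite_finite_induct) auto

lemma exp_growth_componentwise:
  fixes Y :: "'w \<Rightarrow> 'b::euclidean_space"
  assumes "\<And>b. b \<in> Basis \<Longrightarrow> exp_growth M Z (\<lambda>\<omega>. Y \<omega> \<bullet> b)"
  shows "exp_growth M Z Y"
proof -
  have "exp_growth M Z (\<lambda>\<omega>. \<Sum>b\<in>Basis. (Y \<omega> \<bullet> b) *\<^sub>R b)"
    using assms by (intro exp_growth_sum exp_growth_scaleR exp_growth_const)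
  then show ?thesis by (simp add: euclidean_representation)
qed

lemma exp_growth_vec:
  fixes Y :: "'w \<Rightarrow> 'b::euclidean_space ^ 'n"
  assumes "\<And>i. exp_growth M Z (\<lambda>\<omega>. Y \<omega> $ i)"
  shows "exp_growth M Z Y"
proof (rule exp_growth_componentwise)
  fix b :: "'b ^ 'n" assume "b \<in> Basis"
  then obtain i u where b: "b = axis i u" "u \<in> Basis" by (auto simp: Basis_vec_def)
  obtain C c where B: "0 \<le> C" "0 \<le> c" "\<And>\<omega>. norm (Y \<omega> $ i) \<le> C * exp (c * norm (Z \<omega>))"
    using exp_growthE[OF assms(1)[of i]] by blast
  show "exp_growth M Z (\<lambda>\<omega>. Y \<omega> \<bullet> b)" unfolding b inner_axis
  proof (rule exp_growthI)
    show "(\<lambda>\<omega>. Y \<omega> $ i \<bullet> u) \<in> borel_measurable M"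
      using exp_growth_measurable[OF assms[of i]] by measurable
    show "norm (Y \<omega> $ i \<bullet> u) \<le> C * exp (c * norm (Z \<omega>))" for \<omega>
      using B(3)[of \<omega>] Basis_le_norm[OF b(2), of "Y \<omega> $ i"] by simp
  qed
qed

lemma exp_growth_inner:
  fixes Z :: "'w \<Rightarrow> 'z::euclidean_space"
  assumes [measurable]: "Z \<in> borel_measurable M"
  shows "exp_growth M Z (\<lambda>\<omega>. u \<bullet> Z \<omega>)"
proof (rule exp_growthI[of _ _ "norm u" 1])
  fix \<omega>
  have "\<bar>u \<bullet> Z \<omega>\<bar> \<le> norm u * norm (Z \<omega>)" by (rule Cauchy_Schwarz_ineq2)
  also have "\<dots> \<le> norm u * exp (norm (Z \<omega>))"
    using exp_ge_add_one_self[of "norm (Z \<omega>)"] by (intro mult_left_mono norm_ge_zero) linarith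
  finally show "norm (u \<bullet> Z \<omega>) \<le> norm u * exp (1 * norm (Z \<omega>))" by simp
qed simp

lemma exp_growth_exp_inner:
  fixes Z :: "'w \<Rightarrow> 'z::euclidean_space"
  assumes [measurable]: "Z \<in> borel_measurable M"
  shows "exp_growth M Z (\<lambda>\<omega>. exp (u \<bullet> Z \<omega>))"
  by (rule exp_growthI[of _ _ 1 "norm u"])
    (auto intro: norm_cauchy_schwarz)

text \<open>
  This lemma supplies the integrability of every derivative integrand below: those integrands are a
  weight times a quantity of exponential growth.
\<close>

lemma integrable_exp_growth:
  fixes Y :: "'w \<Rightarrow> 'b::euclidean_space"
  assumes "exp_integrable M Z W" "exp_growth M Z Y"
  shows "integrable M (\<lambda>\<omega>. W \<omega> *\<^sub>R Y \<omega>)"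
proof -
  obtain C c where Y: "0 \<le> C" "0 \<le> c" "\<And>\<omega>. norm (Y \<omega>) \<le> C * exp (c * norm (Z \<omega>))"
    using exp_growthE[OF assms(2)] by blast
  have m: "(\<lambda>\<omega>. W \<omega> *\<^sub>R Y \<omega>) \<in> borel_measurable M"
    using assms by (auto simp: exp_growth_def exp_integrable_def)
  have "integrable M (\<lambda>\<omega>. C * (W \<omega> * exp (c * norm (Z \<omega>))))"
    using assms(1) by (auto simp: exp_integrable_def)
  then show ?thesis
  proof (rule Bochner_Integration.integrable_bound[OF _ m], intro AE_I2)
    fix \<omega>
    have "norm (W \<omega> *\<^sub>R Y \<omega>) \<le> \<bar>W \<omega>\<bar> * (C * exp (c * norm (Z \<omega>)))"
      using Y(3)[of \<omega>] by (auto intro: mult_left_mono)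
    then show "norm (W \<omega> *\<^sub>R Y \<omega>) \<le> norm (C * (W \<omega> * exp (c * norm (Z \<omega>))))"
      using Y(1) by (simp add: abs_mult mult_ac)
  qed
qed

text \<open>
  The closure property that lets one differentiate repeatedly: derivatives of a tilted expectation
  are tilted expectations with such a modified weight.
\<close>

lemma exp_integrable_mult:
  assumes "exp_integrable M Z W" "exp_growth M Z Y" and [measurable]: "Z \<in> borel_measurable M"
  shows "exp_integrable M Z (\<lambda>\<omega>. W \<omega> * Y \<omega>)"
  unfolding exp_integrable_def
proof (intro conjI allI)
  show "(\<lambda>\<omega>. W \<omega> * Y \<omega>) \<in> borel_measurable M"
    using assms by (auto simp: exp_growth_def exp_integrable_def)
  fix c
  have "exp_growth M Z (\<lambda>\<omega>. exp (c * norm (Z \<omega>)))"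
    by (rule exp_growthI[of _ _ 1 c]) auto
  from integrable_exp_growth[OF assms(1) exp_growth_mult[OF assms(2) this]]
  show "integrable M (\<lambda>\<omega>. W \<omega> * Y \<omega> * exp (c * norm (Z \<omega>)))" by (simp add: mult.assoc)
qed

lemma exp_growth_bounded_linear:
  fixes Y :: "'w \<Rightarrow> 'b::euclidean_space" and T :: "'b \<Rightarrow> 'c::euclidean_space"
  assumes "bounded_linear T" "exp_growth M Z Y"
  shows "exp_growth M Z (\<lambda>\<omega>. T (Y \<omega>))"
proof -
  obtain K where K: "0 \<le> K" "\<And>y. norm (T y) \<le> norm y * K"
    using bounded_linear.nonneg_bounded[OF assms(1)] by blast
  obtain C c where Y: "\<And>\<omega>. norm (Y \<omega>) \<le> C * exp (c * norm (Z \<omega>))"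
    using exp_growthE[OF assms(2)] by metis
  show ?thesis
  proof (rule exp_growthI)
    have [measurable]: "T \<in> borel_measurable borel"
      by (rule borel_measurable_continuous_onI[OF linear_continuous_on[OF assms(1)]])
    show "(\<lambda>\<omega>. T (Y \<omega>)) \<in> borel_measurable M"
      using exp_growth_measurable[OF assms(2)] by measurable
    show "norm (T (Y \<omega>)) \<le> (C * K) * exp (c * norm (Z \<omega>))" for \<omega>
      using order.trans[OF K(2) mult_right_mono[OF Y K(1)], of \<omega>] by (simp add: mult_ac)
  qed
qed

lemma exp_growth_outer:
  fixes X :: "'w \<Rightarrow> real ^ 'm" and Y :: "'w \<Rightarrow> real ^ 'n"
  assumes "exp_growth M Z X" "exp_growth M Z Y"
  shows "exp_growth M Z (\<lambda>\<omega>. outer (X \<omega>) (Y \<omega>))"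
  by (intro exp_growth_vec)
    (auto simp: outer_def intro!: exp_growth_mult assms exp_growth_bounded_linear[OF bounded_linear_vec_nth])

section \<open>Derivative of a Laplace transform\<close>

lemma exp_remainder_bound: "\<bar>exp t - 1 - t\<bar> \<le> t\<^sup>2 * exp \<bar>t\<bar>" for t :: real
proof -
  obtain s where s: "\<bar>s\<bar> \<le> \<bar>t\<bar>" "exp t = (\<Sum>m<2. t ^ m / fact m) + exp s / fact 2 * t ^ 2"
    using Maclaurin_exp_le[of t 2] by blast
  have eq: "exp t - 1 - t = exp s / 2 * t\<^sup>2" using s(2) by (simp add: numeral_2_eq_2)
  have "exp s / 2 * t\<^sup>2 \<le> exp \<bar>t\<bar> * t\<^sup>2"
  proof (rule mult_right_mono)
    have "exp s / 2 \<le> exp s" by simp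
    also have "exp s \<le> exp \<bar>t\<bar>" using s(1) by simp
    finally show "exp s / 2 \<le> exp \<bar>t\<bar>" .
  qed simp
  moreover have "0 \<le> exp s / 2 * t\<^sup>2" by simp
  ultimately show ?thesis unfolding eq by (simp only: abs_of_nonneg mult.commute)
qed

lemma has_derivative_quadratic_remainder:
  assumes "bounded_linear D" "0 \<le> B"
    and "\<And>h. norm h \<le> 1 \<Longrightarrow> norm (f (x + h) - f x - D h) \<le> B * (norm h)\<^sup>2"
  shows "(f has_derivative D) (at x)"
  unfolding has_derivative_at_alt
proof (intro conjI assms(1) allI impI)
  fix e :: real assume "0 < e"
  show "\<exists>d>0. \<forall>y. norm (y - x) < d \<longrightarrow> norm (f y - f x - D (y - x)) \<le> e * norm (y - x)"
  \<comment> \<open>\<open>B + 1\<close> rather than \<open>B\<close> avoids a division by zero when \<open>B = 0\<close>.\<close>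
  proof (intro exI[of _ "min 1 (e / (B + 1))"] conjI allI impI)
    show "0 < min 1 (e / (B + 1))" using \<open>0 < e\<close> assms(2) by simp
    fix y assume y: "norm (y - x) < min 1 (e / (B + 1))"
    have "norm (f y - f x - D (y - x)) \<le> B * (norm (y - x))\<^sup>2"
      using assms(3)[of "y - x"] y by simp
    also have "\<dots> = (B * norm (y - x)) * norm (y - x)" by (simp add: power2_eq_square)
    also have "\<dots> \<le> e * norm (y - x)"
    proof (intro mult_right_mono)
      have "(B + 1) * norm (y - x) < e" using y assms(2) by (simp add: field_simps)
      moreover have "B * norm (y - x) \<le> (B + 1) * norm (y - x)" by (intro mult_right_mono) auto
      ultimately show "B * norm (y - x) \<le> e" by linarith
    qed simp
    finally show "norm (f y - f x - D (y - x)) \<le> e * norm (y - x)" .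
  qed
qed

text \<open>
  With \<open>t = h \<bullet> Z\<close> and \<open>\<bar>h\<bar> \<le> 1\<close>, the remainder bound for \<open>exp\<close> dominates the first order error of the
  integrand by \<open>\<bar>h\<bar>\<^sup>2\<close> times the random variable \<open>\<bar>W\<bar> \<bar>Z\<bar>\<^sup>2 exp \<bar>Z\<bar> exp (z \<bullet> Z)\<close>, which is integrable and
  does not depend on \<open>h\<close>.
\<close>

lemma has_derivative_Laplace_transform:
  fixes Z :: "'w \<Rightarrow> 'z::euclidean_space"
  assumes W: "exp_integrable M Z W" and Z[measurable]: "Z \<in> borel_measurable M"
  shows "((\<lambda>z. \<integral>\<omega>. W \<omega> * exp (z \<bullet> Z \<omega>) \<partial>M) has_derivative
          (\<lambda>h. \<integral>\<omega>. W \<omega> * ((h \<bullet> Z \<omega>) * exp (z \<bullet> Z \<omega>)) \<partial>M)) (at z)"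
proof -
  have i0: "integrable M (\<lambda>\<omega>. W \<omega> * exp (u \<bullet> Z \<omega>))" for u
    using integrable_exp_growth[OF W exp_growth_exp_inner[OF Z, of u]] by simp
  have i1: "integrable M (\<lambda>\<omega>. W \<omega> * ((h \<bullet> Z \<omega>) * exp (u \<bullet> Z \<omega>)))" for h u
    using integrable_exp_growth[OF W exp_growth_mult[OF exp_growth_inner[OF Z, of h] exp_growth_exp_inner[OF Z, of u]]]
    by simp
  define R where "R \<omega> = W \<omega> * ((norm (Z \<omega>))\<^sup>2 * exp (norm (Z \<omega>)) * exp (z \<bullet> Z \<omega>))" for \<omega>
  have gn: "exp_growth M Z (\<lambda>\<omega>. norm (Z \<omega>))"
    by (rule exp_growthI[of _ _ 1 1]) (auto intro: order.trans[OF _ exp_ge_add_one_self])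
  have ge: "exp_growth M Z (\<lambda>\<omega>. exp (norm (Z \<omega>)))"
    by (rule exp_growthI[of _ _ 1 1]) auto
  have iR: "integrable M R"
    using integrable_exp_growth[OF W exp_growth_mult[OF exp_growth_mult[OF exp_growth_mult[OF gn gn] ge]
        exp_growth_exp_inner[OF Z, of z]]]
    by (simp add: R_def[abs_def] power2_eq_square)
  show ?thesis
  proof (rule has_derivative_quadratic_remainder)
    show "0 \<le> (\<integral>\<omega>. \<bar>R \<omega>\<bar> \<partial>M)" by simp
    show "bounded_linear (\<lambda>h. \<integral>\<omega>. W \<omega> * ((h \<bullet> Z \<omega>) * exp (z \<bullet> Z \<omega>)) \<partial>M)"
      unfolding linear_conv_bounded_linear[symmetric]
    proof (rule linearI)
      show "(\<integral>\<omega>. W \<omega> * (((h + k) \<bullet> Z \<omega>) * exp (z \<bullet> Z \<omega>)) \<partial>M) =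
          (\<integral>\<omega>. W \<omega> * ((h \<bullet> Z \<omega>) * exp (z \<bullet> Z \<omega>)) \<partial>M) + (\<integral>\<omega>. W \<omega> * ((k \<bullet> Z \<omega>) * exp (z \<bullet> Z \<omega>)) \<partial>M)"
        for h k
        by (subst Bochner_Integration.integral_add[OF i1 i1, symmetric])
          (simp add: inner_add_left algebra_simps)
      show "(\<integral>\<omega>. W \<omega> * (((r *\<^sub>R h) \<bullet> Z \<omega>) * exp (z \<bullet> Z \<omega>)) \<partial>M) =
          r *\<^sub>R (\<integral>\<omega>. W \<omega> * ((h \<bullet> Z \<omega>) * exp (z \<bullet> Z \<omega>)) \<partial>M)" for r h
        by (subst integral_scaleR_right[symmetric]) (simp add: mult_ac)
    qed
    fix h :: 'z assume h: "norm h \<le> 1"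
    have "(\<integral>\<omega>. W \<omega> * exp ((z + h) \<bullet> Z \<omega>) \<partial>M) - (\<integral>\<omega>. W \<omega> * exp (z \<bullet> Z \<omega>) \<partial>M) -
        (\<integral>\<omega>. W \<omega> * ((h \<bullet> Z \<omega>) * exp (z \<bullet> Z \<omega>)) \<partial>M) =
        (\<integral>\<omega>. W \<omega> * exp ((z + h) \<bullet> Z \<omega>) - W \<omega> * exp (z \<bullet> Z \<omega>) - W \<omega> * ((h \<bullet> Z \<omega>) * exp (z \<bullet> Z \<omega>)) \<partial>M)"
      using i0 i1 by simp
    also have "norm \<dots> \<le> (\<integral>\<omega>. \<bar>R \<omega>\<bar> * (norm h)\<^sup>2 \<partial>M)"
    proof (rule order.trans[OF integral_norm_bound integral_mono[OF integrable_norm]])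
      show "integrable M (\<lambda>\<omega>. W \<omega> * exp ((z + h) \<bullet> Z \<omega>) - W \<omega> * exp (z \<bullet> Z \<omega>) - W \<omega> * ((h \<bullet> Z \<omega>) * exp (z \<bullet> Z \<omega>)))"
        using i0 i1 by (intro Bochner_Integration.integrable_diff)
      show "integrable M (\<lambda>\<omega>. \<bar>R \<omega>\<bar> * (norm h)\<^sup>2)" using iR by simp
      fix \<omega>
      have cs: "\<bar>h \<bullet> Z \<omega>\<bar> \<le> norm h * norm (Z \<omega>)" by (rule Cauchy_Schwarz_ineq2)
      have sq: "(h \<bullet> Z \<omega>)\<^sup>2 \<le> (norm h)\<^sup>2 * (norm (Z \<omega>))\<^sup>2"
        using power_mono[OF cs, of 2] by (simp add: power_mult_distrib)
      have "norm h * norm (Z \<omega>) \<le> norm (Z \<omega>)" using h by (simp add: mult_left_le_one_le)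
      with cs have ex: "exp \<bar>h \<bullet> Z \<omega>\<bar> \<le> exp (norm (Z \<omega>))" by simp
      have "\<bar>exp (h \<bullet> Z \<omega>) - 1 - h \<bullet> Z \<omega>\<bar> \<le> (h \<bullet> Z \<omega>)\<^sup>2 * exp \<bar>h \<bullet> Z \<omega>\<bar>"
        by (rule exp_remainder_bound)
      also have "\<dots> \<le> ((norm h)\<^sup>2 * (norm (Z \<omega>))\<^sup>2) * exp (norm (Z \<omega>))"
        using sq ex by (intro mult_mono) auto
      finally have r: "\<bar>exp (h \<bullet> Z \<omega>) - 1 - h \<bullet> Z \<omega>\<bar> \<le> (norm h)\<^sup>2 * (norm (Z \<omega>))\<^sup>2 * exp (norm (Z \<omega>))" .
      have "W \<omega> * exp ((z + h) \<bullet> Z \<omega>) - W \<omega> * exp (z \<bullet> Z \<omega>) - W \<omega> * ((h \<bullet> Z \<omega>) * exp (z \<bullet> Z \<omega>)) =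
        (W \<omega> * exp (z \<bullet> Z \<omega>)) * (exp (h \<bullet> Z \<omega>) - 1 - h \<bullet> Z \<omega>)"
        by (simp add: inner_add_left exp_add algebra_simps)
      also have "norm \<dots> \<le> \<bar>W \<omega> * exp (z \<bullet> Z \<omega>)\<bar> * ((norm h)\<^sup>2 * (norm (Z \<omega>))\<^sup>2 * exp (norm (Z \<omega>)))"
        unfolding real_norm_def abs_mult[of "W \<omega> * exp (z \<bullet> Z \<omega>)"] by (rule mult_left_mono[OF r]) simp
      also have "\<dots> = \<bar>R \<omega>\<bar> * (norm h)\<^sup>2"
        by (simp add: R_def abs_mult mult_ac)
      finally show "norm (W \<omega> * exp ((z + h) \<bullet> Z \<omega>) - W \<omega> * exp (z \<bullet> Z \<omega>) - W \<omega> * ((h \<bullet> Z \<omega>) * exp (z \<bullet> Z \<omega>)))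
        \<le> \<bar>R \<omega>\<bar> * (norm h)\<^sup>2" .
    qed
    also have "\<dots> = (\<integral>\<omega>. \<bar>R \<omega>\<bar> \<partial>M) * (norm h)\<^sup>2" by simp
    finally show "norm ((\<integral>\<omega>. W \<omega> * exp ((z + h) \<bullet> Z \<omega>) \<partial>M) - (\<integral>\<omega>. W \<omega> * exp (z \<bullet> Z \<omega>) \<partial>M) -
        (\<integral>\<omega>. W \<omega> * ((h \<bullet> Z \<omega>) * exp (z \<bullet> Z \<omega>)) \<partial>M)) \<le> (\<integral>\<omega>. \<bar>R \<omega>\<bar> \<partial>M) * (norm h)\<^sup>2" .
  qed
qed

section \<open>The tilted expectations and their gradient\<close>

lemma open_dom_v: "open (dom_v :: ((real ^ 'd) \<times> (real ^ 'p)) set)"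
proof -
  have "{lam :: real ^ 'p. \<forall>i. 0 < lam $ i} = (\<Inter>i. {lam. 0 < lam $ i})" by auto
  moreover have "open (\<Inter>i. {lam :: real ^ 'p. 0 < lam $ i})"
    by (intro open_INT ballI open_Collect_less continuous_intros) auto
  ultimately show ?thesis unfolding dom_v_def by (auto intro: open_Times)
qed

lemma convex_dom_v: "convex (dom_v :: ((real ^ 'd) \<times> (real ^ 'p)) set)"
proof -
  have "{lam :: real ^ 'p. \<forall>i. 0 < lam $ i} = (\<Inter>i. {lam. lam $ i > 0})" by auto
  moreover have "convex {lam :: real ^ 'p. lam $ i > 0}" for i
    using convex_halfspace_gt[of 0 "axis i 1 :: real ^ 'p"] by (simp add: inner_axis')
  ultimately show ?thesis unfolding dom_v_def by (auto intro!: convex_Times convex_INT)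
qed

lemma snd_dom_v_pos: "x \<in> dom_v \<Longrightarrow> 0 < snd x $ i"
  by (cases x) (auto simp: dom_v_def)

lemma has_derivative_chi:
  fixes f :: "'n::finite \<Rightarrow> 'a::real_normed_vector \<Rightarrow> real"
  assumes "\<And>i. (f i has_derivative f' i) (at x)"
  shows "((\<lambda>x. \<chi> i. f i x) has_derivative (\<lambda>h. \<chi> i. f' i h)) (at x)"
  by (subst has_derivative_componentwise_within)
    (use assms in \<open>auto simp: Basis_vec_def inner_axis\<close>)

text \<open>
  The laws of \<open>G\<close> and \<open>N\<close> enter the lemmas of this context through two assumptions: a weight is
  \<open>exp_integrable\<close> with respect to \<open>Z = (G, N)\<close>, and it is nonzero with positive probability on an
  event \<open>N = n\<close>.
\<close>

locale gauss_poisson_tilt =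
  fixes M :: "'w measure" and G :: "'w \<Rightarrow> real ^ 'd" and N :: "'w \<Rightarrow> nat ^ 'p" and \<mu> :: "real ^ 'p"
  assumes mu_pos: "0 < \<mu> $ i"
    and G_measurable [measurable]: "G \<in> borel_measurable M"
    and N_measurable [measurable]: "N \<in> measurable M (count_space UNIV)"
begin

definition Z :: "'w \<Rightarrow> (real ^ 'd) \<times> (real ^ 'p)" where
  "Z \<omega> = (G \<omega>, \<chi> i. real (N \<omega> $ i))"

definition tilt :: "(real ^ 'd) \<times> (real ^ 'p) \<Rightarrow> 'w \<Rightarrow> real" where
  "tilt x \<omega> = exp (- (fst x \<bullet> G \<omega>) + (norm (fst x))\<^sup>2 / 2) *
     (\<Prod>i\<in>UNIV. exp (snd x $ i - \<mu> $ i) * (\<mu> $ i / snd x $ i) ^ (N \<omega> $ i))"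

definition tilted_mean :: "('w \<Rightarrow> real) \<Rightarrow> (real ^ 'd) \<times> (real ^ 'p) \<Rightarrow> real" where
  "tilted_mean W x = (\<integral>\<omega>. W \<omega> * tilt x \<omega> \<partial>M)"

text \<open>
  The gradient of \<open>ln (tilt x)\<close> with respect to \<open>x = (\<theta>, \<lambda>)\<close>.
\<close>

definition score :: "(real ^ 'd) \<times> (real ^ 'p) \<Rightarrow> 'w \<Rightarrow> (real ^ 'd) \<times> (real ^ 'p)" where
  "score x \<omega> = (fst x - G \<omega>, a_vec (N \<omega>) (snd x))"

text \<open>
  The derivative in direction \<open>h\<close> of \<open>score\<close>, that is, the Hessian of \<open>ln (tilt x)\<close> applied to \<open>h\<close>.
\<close>

definition score_deriv ::
  "(real ^ 'd) \<times> (real ^ 'p) \<Rightarrow> 'w \<Rightarrow> (real ^ 'd) \<times> (real ^ 'p) \<Rightarrow> (real ^ 'd) \<times> (real ^ 'p)" where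
  "score_deriv x \<omega> h = (fst h, D_mat (N \<omega>) (snd x) *v snd h)"

text \<open>
  The natural parameter of the exponential family formed by the functions \<open>tilt x\<close>; the sufficient
  statistic is \<open>Z\<close>.
\<close>

definition nat_param :: "(real ^ 'd) \<times> (real ^ 'p) \<Rightarrow> (real ^ 'd) \<times> (real ^ 'p)" where
  "nat_param x = (- fst x, \<chi> i. ln (\<mu> $ i) - ln (snd x $ i))"

definition tilt_factor :: "(real ^ 'd) \<times> (real ^ 'p) \<Rightarrow> real" where
  "tilt_factor x = exp (fst x \<bullet> fst x / 2 + (\<Sum>i\<in>UNIV. snd x $ i - \<mu> $ i))"

lemma Z_measurable [measurable]: "Z \<in> borel_measurable M"
proof -
  have [measurable]: "(\<lambda>\<omega>. \<chi> i. real (N \<omega> $ i)) \<in> borel_measurable M"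
    by (subst borel_measurable_euclidean_space) (auto simp: Basis_vec_def inner_axis)
  show ?thesis unfolding Z_def[abs_def] by measurable
qed

lemma tilt_eq:
  assumes "x \<in> dom_v"
  shows "tilt x \<omega> = tilt_factor x * exp (nat_param x \<bullet> Z \<omega>)"
proof -
  have l: "0 < snd x $ i" for i using snd_dom_v_pos[OF assms] .
  have "exp (snd x $ i - \<mu> $ i) * (\<mu> $ i / snd x $ i) ^ (N \<omega> $ i) =
      exp ((snd x $ i - \<mu> $ i) + (ln (\<mu> $ i) - ln (snd x $ i)) * real (N \<omega> $ i))" for i
  proof -
    have "\<mu> $ i / snd x $ i = exp (ln (\<mu> $ i) - ln (snd x $ i))"
      using mu_pos[of i] l[of i] by (simp add: exp_diff)
    then have "(\<mu> $ i / snd x $ i) ^ (N \<omega> $ i) = exp ((ln (\<mu> $ i) - ln (snd x $ i)) * real (N \<omega> $ i))"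
      by (simp add: exp_of_nat_mult[symmetric] mult.commute)
    then show ?thesis by (simp add: exp_add)
  qed
  then have "tilt x \<omega> = exp (- (fst x \<bullet> G \<omega>) + (norm (fst x))\<^sup>2 / 2) *
     exp (\<Sum>i\<in>UNIV. (snd x $ i - \<mu> $ i) + (ln (\<mu> $ i) - ln (snd x $ i)) * real (N \<omega> $ i))"
    unfolding tilt_def by (simp add: exp_sum)
  also have "\<dots> = tilt_factor x * exp (nat_param x \<bullet> Z \<omega>)"
    unfolding tilt_factor_def nat_param_def Z_def
    by (simp add: exp_add[symmetric] sum.distrib inner_vec_def[of "vec_lambda _"] power2_norm_eq_inner)
  finally show ?thesis .
qed

lemma tilt_pos: "x \<in> dom_v \<Longrightarrow> 0 < tilt x \<omega>"
  by (simp add: tilt_eq tilt_factor_def)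

lemma exp_growth_tilt: "x \<in> dom_v \<Longrightarrow> exp_growth M Z (tilt x)"
  using exp_growth_mult[OF exp_growth_const exp_growth_exp_inner[OF Z_measurable, of "nat_param x"], of "tilt_factor x"]
  by (subst ext[of "tilt x" "\<lambda>\<omega>. tilt_factor x * exp (nat_param x \<bullet> Z \<omega>)"]) (simp_all add: tilt_eq)

lemma exp_growth_G: "exp_growth M Z (\<lambda>\<omega>. u \<bullet> G \<omega>)"
  using exp_growth_inner[OF Z_measurable, of "(u, 0)"] by (simp add: Z_def)

lemma exp_growth_N: "exp_growth M Z (\<lambda>\<omega>. real (N \<omega> $ i))"
  using exp_growth_inner[OF Z_measurable, of "(0, axis i 1)"] by (simp add: Z_def inner_axis')

text \<open>
  An affine function of \<open>Z\<close>. The coefficient of \<open>Z\<close> is minus the one that occurs in the derivative of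
  \<open>nat_param\<close>, which is why differentiating the exponential produces the score.
\<close>

lemma score_inner:
  "score x \<omega> \<bullet> h = fst x \<bullet> fst h + (\<Sum>i\<in>UNIV. snd h $ i) -
     (fst h, \<chi> i. snd h $ i / snd x $ i) \<bullet> Z \<omega>"
  by (cases h) (simp add: score_def Z_def a_vec_def inner_vec_def[of "vec_lambda _"] inner_diff_left
      algebra_simps sum_subtractf inner_commute[of "G \<omega>"])

lemma score_deriv_inner:
  "score_deriv x \<omega> h \<bullet> k = fst h \<bullet> fst k +
     (\<Sum>i\<in>UNIV. snd k $ i * snd h $ i / (snd x $ i)\<^sup>2 * real (N \<omega> $ i))"
proof -
  have "(D_mat (N \<omega>) (snd x) *v snd h) $ i = real (N \<omega> $ i) / (snd x $ i)\<^sup>2 * snd h $ i" for i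
    by (simp add: D_mat_def matrix_vector_mult_def if_distrib[of "\<lambda>a. a * _"] cong: if_cong)
  then show ?thesis
    by (cases k) (simp add: score_deriv_def inner_vec_def[of "_ *v _"] mult_ac)
qed

lemma exp_growth_score_inner: "exp_growth M Z (\<lambda>\<omega>. score x \<omega> \<bullet> h)"
  unfolding score_inner by (intro exp_growth_diff exp_growth_const exp_growth_inner Z_measurable)

lemma exp_growth_score: "exp_growth M Z (score x)"
  by (rule exp_growth_componentwise) (rule exp_growth_score_inner)

lemma exp_growth_score_deriv: "exp_growth M Z (\<lambda>\<omega>. score_deriv x \<omega> h)"
proof (rule exp_growth_componentwise)
  fix b
  show "exp_growth M Z (\<lambda>\<omega>. score_deriv x \<omega> h \<bullet> b)"
    unfolding score_deriv_inner
    by (intro exp_growth_add exp_growth_sum exp_growth_mult exp_growth_const exp_growth_N)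
qed

lemma exp_integrable_score:
  "exp_integrable M Z W \<Longrightarrow> exp_integrable M Z (\<lambda>\<omega>. W \<omega> * (score x \<omega> \<bullet> h))"
  by (rule exp_integrable_mult[OF _ exp_growth_score_inner Z_measurable])

lemma integrable_tilt_scaleR:
  fixes Y :: "'w \<Rightarrow> 'b::euclidean_space"
  assumes "exp_integrable M Z W" "x \<in> dom_v" "exp_growth M Z Y"
  shows "integrable M (\<lambda>\<omega>. (W \<omega> * tilt x \<omega>) *\<^sub>R Y \<omega>)"
  using integrable_exp_growth[OF exp_integrable_mult[OF assms(1) exp_growth_tilt[OF assms(2)] Z_measurable] assms(3)] .

lemma integrable_tilt_mult:
  assumes "exp_integrable M Z W" "x \<in> dom_v" "exp_growth M Z Y"
  shows "integrable M (\<lambda>\<omega>. W \<omega> * Y \<omega> * tilt x \<omega>)"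
  using integrable_tilt_scaleR[OF assms] by (simp add: mult_ac)

lemma integrable_tilt:
  assumes "exp_integrable M Z W" "x \<in> dom_v"
  shows "integrable M (\<lambda>\<omega>. W \<omega> * tilt x \<omega>)"
  using integrable_tilt_mult[OF assms exp_growth_const[of M Z 1]] by simp

lemma has_derivative_nat_param:
  assumes "x \<in> dom_v"
  shows "(nat_param has_derivative (\<lambda>h. - (fst h, \<chi> i. snd h $ i / snd x $ i))) (at x)"
proof -
  have "((\<lambda>x. ln (\<mu> $ i) - ln (snd x $ i)) has_derivative (\<lambda>h. - (snd h $ i / snd x $ i))) (at x)" for i
    using snd_dom_v_pos[OF assms, of i]
    by (auto intro!: derivative_eq_intros bounded_linear.has_derivative[OF bounded_linear_vec_nth] simp: field_simps)
  from has_derivative_chi[OF this]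
  have "(nat_param has_derivative (\<lambda>h. (- fst h, \<chi> i. - (snd h $ i / snd x $ i)))) (at x)"
    unfolding nat_param_def[abs_def]
    by (intro has_derivative_Pair derivative_intros)
  moreover have "(- fst h, \<chi> i. - (snd h $ i / snd x $ i)) = - (fst h, \<chi> i. snd h $ i / snd x $ i)"
    for h :: "(real ^ 'd) \<times> (real ^ 'p)"
    by (simp add: vec_eq_iff)
  ultimately show ?thesis by (simp only:)
qed

lemma has_derivative_tilt_factor:
  "(tilt_factor has_derivative (\<lambda>h. tilt_factor x * (fst x \<bullet> fst h + (\<Sum>i\<in>UNIV. snd h $ i)))) (at x)"
  unfolding tilt_factor_def[abs_def]
  by (auto intro!: derivative_eq_intros bounded_linear.has_derivative[OF bounded_linear_vec_nth]
      simp: inner_commute algebra_simps)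

text \<open>
  Chain and product rule for the elementary factor times the Laplace transform at \<open>nat_param x\<close>:
  the derivative of the factor contributes the part of the score that is constant in \<open>Z\<close>, the
  derivative of the transform the part linear in \<open>Z\<close>.
\<close>

lemma has_derivative_tilted_mean:
  assumes W: "exp_integrable M Z W" and x: "x \<in> dom_v"
  shows "(tilted_mean W has_derivative (\<lambda>h. tilted_mean (\<lambda>\<omega>. W \<omega> * (score x \<omega> \<bullet> h)) x)) (at x)"
proof -
  let ?L = "\<lambda>z. \<integral>\<omega>. W \<omega> * exp (z \<bullet> Z \<omega>) \<partial>M"
  let ?b = "\<lambda>h. (fst h, \<chi> i. snd h $ i / snd x $ i) :: (real ^ 'd) \<times> (real ^ 'p)"
  let ?c = "\<lambda>h. fst x \<bullet> fst h + (\<Sum>i\<in>UNIV. snd h $ i)"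
  have i0: "integrable M (\<lambda>\<omega>. W \<omega> * exp (u \<bullet> Z \<omega>))" for u
    using integrable_exp_growth[OF W exp_growth_exp_inner[OF Z_measurable, of u]] by simp
  have i1: "integrable M (\<lambda>\<omega>. W \<omega> * ((h \<bullet> Z \<omega>) * exp (u \<bullet> Z \<omega>)))" for h u
    using integrable_exp_growth[OF W exp_growth_mult[OF exp_growth_inner[OF Z_measurable, of h] exp_growth_exp_inner[OF Z_measurable, of u]]]
    by simp
  have L: "((\<lambda>y. ?L (nat_param y)) has_derivative
      (\<lambda>h. \<integral>\<omega>. W \<omega> * ((- ?b h \<bullet> Z \<omega>) * exp (nat_param x \<bullet> Z \<omega>)) \<partial>M)) (at x)"
    by (rule has_derivative_compose[OF has_derivative_nat_param[OF x] has_derivative_Laplace_transform[OF W Z_measurable]])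
  have "((\<lambda>y. tilt_factor y * ?L (nat_param y)) has_derivative
      (\<lambda>h. tilt_factor x * (\<integral>\<omega>. W \<omega> * ((- ?b h \<bullet> Z \<omega>) * exp (nat_param x \<bullet> Z \<omega>)) \<partial>M) +
           (tilt_factor x * ?c h) * ?L (nat_param x))) (at x)"
    by (rule has_derivative_mult[OF has_derivative_tilt_factor L])
  moreover have "tilt_factor y * ?L (nat_param y) = tilted_mean W y" if "y \<in> dom_v" for y
    unfolding tilted_mean_def tilt_eq[OF that] integral_mult_right_zero[symmetric]
    by (simp add: mult_ac)
  ultimately have "(tilted_mean W has_derivative
      (\<lambda>h. tilt_factor x * (\<integral>\<omega>. W \<omega> * ((- ?b h \<bullet> Z \<omega>) * exp (nat_param x \<bullet> Z \<omega>)) \<partial>M) +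
           (tilt_factor x * ?c h) * ?L (nat_param x))) (at x)"
    by (rule has_derivative_transform_within_open[OF _ open_dom_v x])
  moreover have "tilt_factor x * (\<integral>\<omega>. W \<omega> * ((- ?b h \<bullet> Z \<omega>) * exp (nat_param x \<bullet> Z \<omega>)) \<partial>M) +
           (tilt_factor x * ?c h) * ?L (nat_param x) = tilted_mean (\<lambda>\<omega>. W \<omega> * (score x \<omega> \<bullet> h)) x" for h
  proof -
    have "tilt_factor x * (\<integral>\<omega>. W \<omega> * ((- ?b h \<bullet> Z \<omega>) * exp (nat_param x \<bullet> Z \<omega>)) \<partial>M) +
           (tilt_factor x * ?c h) * ?L (nat_param x) =
      (\<integral>\<omega>. tilt_factor x * (W \<omega> * ((- ?b h \<bullet> Z \<omega>) * exp (nat_param x \<bullet> Z \<omega>))) +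
         (tilt_factor x * ?c h) * (W \<omega> * exp (nat_param x \<bullet> Z \<omega>)) \<partial>M)"
      unfolding integral_mult_right_zero[symmetric]
      by (rule Bochner_Integration.integral_add[symmetric]; intro integrable_mult_right i0 i1)
    also have "\<dots> = tilted_mean (\<lambda>\<omega>. W \<omega> * (score x \<omega> \<bullet> h)) x"
      unfolding tilted_mean_def tilt_eq[OF x] score_inner inner_minus_left
      by (rule Bochner_Integration.integral_cong[OF refl]) (simp add: algebra_simps)
    finally show ?thesis .
  qed
  ultimately show ?thesis by simp
qed

text \<open>
  The score depends on \<open>x\<close>, but this expansion moves the dependence out of the expectations, into
  smooth coefficients; the weights on the right are independent of \<open>x\<close> and can be differentiated by
  the same rule.
\<close>

lemma tilted_mean_score:
  assumes W: "exp_integrable M Z W" and x: "x \<in> dom_v"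
  shows "tilted_mean (\<lambda>\<omega>. W \<omega> * (score x \<omega> \<bullet> h)) x =
     (fst x \<bullet> fst h + (\<Sum>i\<in>UNIV. snd h $ i)) * tilted_mean W x
     - tilted_mean (\<lambda>\<omega>. W \<omega> * (fst h \<bullet> G \<omega>)) x
     - (\<Sum>i\<in>UNIV. snd h $ i * inverse (snd x $ i) * tilted_mean (\<lambda>\<omega>. W \<omega> * real (N \<omega> $ i)) x)"
proof -
  note i0 = integrable_tilt[OF W x]
    and iG = integrable_tilt_mult[OF W x exp_growth_G] and iN = integrable_tilt_mult[OF W x exp_growth_N]
  have "W \<omega> * (score x \<omega> \<bullet> h) * tilt x \<omega> =
      (fst x \<bullet> fst h + (\<Sum>i\<in>UNIV. snd h $ i)) * (W \<omega> * tilt x \<omega>) - W \<omega> * (fst h \<bullet> G \<omega>) * tilt x \<omega>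
      - (\<Sum>i\<in>UNIV. snd h $ i * inverse (snd x $ i) * (W \<omega> * real (N \<omega> $ i) * tilt x \<omega>))" for \<omega>
  proof -
    have "score x \<omega> \<bullet> h = (fst x \<bullet> fst h + (\<Sum>i\<in>UNIV. snd h $ i)) - fst h \<bullet> G \<omega>
        - (\<Sum>i\<in>UNIV. snd h $ i * inverse (snd x $ i) * real (N \<omega> $ i))"
      unfolding score_inner Z_def by (simp add: inner_vec_def[of "vec_lambda _"] divide_inverse)
    moreover have "W \<omega> * (a - b - c) * tilt x \<omega> =
        a * (W \<omega> * tilt x \<omega>) - W \<omega> * b * tilt x \<omega> - c * (W \<omega> * tilt x \<omega>)" for a b c
      by (simp add: algebra_simps)
    ultimately show ?thesis by (simp only:) (simp add: sum_distrib_left mult_ac)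
  qed
  then show ?thesis
    unfolding tilted_mean_def
    by (simp add: i0 iG iN)
qed

section \<open>Smoothness\<close>

text \<open>
  The induction must range over all weights at once: one derivative replaces \<open>W\<close> by the weights
  \<open>W\<close>, \<open>W (h\<^sub>1 \<bullet> G)\<close> and \<open>W N\<^sub>i\<close>.
\<close>

lemma Ck_on_tilted_mean: "exp_integrable M Z W \<Longrightarrow> Ck_on k (tilted_mean W) dom_v"
proof (induction k arbitrary: W)
  case 0
  have "isCont (tilted_mean W) x" if "x \<in> dom_v" for x
    by (rule has_derivative_continuous[OF has_derivative_tilted_mean[OF 0 that]])
  then show ?case by (simp add: continuous_at_imp_continuous_on)
next
  case (Suc k)
  note W = \<open>exp_integrable M Z W\<close>
  show ?case
  proof (rule Ck_on_SucI[OF open_dom_v has_derivative_tilted_mean[OF W]])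
    fix h :: "(real ^ 'd) \<times> (real ^ 'p)"
    \<comment> \<open>The coefficients in \<open>tilted_mean_score\<close> are affine functions and reciprocals of coordinates.\<close>
    have 1: "Ck_on k (\<lambda>x. fst x \<bullet> fst h + (\<Sum>i\<in>UNIV. snd h $ i)) dom_v"
      by (intro Ck_on_add Ck_on_const open_dom_v Ck_on_bounded_linear)
        (rule bounded_linear_compose[OF bounded_linear_inner_left bounded_linear_fst])
    have 2: "Ck_on k (\<lambda>x. inverse (snd x $ i)) dom_v" for i
      by (intro Ck_on_inverse open_dom_v Ck_on_bounded_linear)
        (auto intro: bounded_linear_compose[OF bounded_linear_vec_nth bounded_linear_snd] dest: snd_dom_v_pos[of _ i])
    have G: "Ck_on k (tilted_mean (\<lambda>\<omega>. W \<omega> * (fst h \<bullet> G \<omega>))) dom_v"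
      by (rule Suc.IH[OF exp_integrable_mult[OF W exp_growth_G Z_measurable]])
    have N: "Ck_on k (tilted_mean (\<lambda>\<omega>. W \<omega> * real (N \<omega> $ i))) dom_v" for i
      by (rule Suc.IH[OF exp_integrable_mult[OF W exp_growth_N Z_measurable]])
    have "Ck_on k (\<lambda>x. (fst x \<bullet> fst h + (\<Sum>i\<in>UNIV. snd h $ i)) * tilted_mean W x
     - tilted_mean (\<lambda>\<omega>. W \<omega> * (fst h \<bullet> G \<omega>)) x
     - (\<Sum>i\<in>UNIV. snd h $ i * inverse (snd x $ i) * tilted_mean (\<lambda>\<omega>. W \<omega> * real (N \<omega> $ i)) x)) dom_v"
      by (intro Ck_on_diff Ck_on_mult Ck_on_sum Ck_on_const open_dom_v 1 2 G N Suc.IH[OF W] finite)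
    then show "Ck_on k (\<lambda>x. tilted_mean (\<lambda>\<omega>. W \<omega> * (score x \<omega> \<bullet> h)) x) dom_v"
      by (rule Ck_on_cong[OF open_dom_v]) (simp add: tilted_mean_score[OF W])
  qed
qed

section \<open>Second derivatives\<close>

lemma inner_integral_tilt:
  fixes Y :: "'w \<Rightarrow> 'b::euclidean_space"
  assumes "exp_integrable M Z W" "x \<in> dom_v" "exp_growth M Z Y"
  shows "(\<integral>\<omega>. (W \<omega> * tilt x \<omega>) *\<^sub>R Y \<omega> \<partial>M) \<bullet> b = tilted_mean (\<lambda>\<omega>. W \<omega> * (Y \<omega> \<bullet> b)) x"
  unfolding tilted_mean_def
  using integral_inner_left[OF integrable_tilt_scaleR[OF assms], of b, symmetric]
  by (simp add: mult_ac)

text \<open>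
  Along a fixed direction \<open>b\<close> the expansion \<open>tilted_mean_score\<close> is differentiated by the product rule.
  The terms in which a tilted expectation is differentiated recombine, by the same expansion for the
  weight \<open>W (score x \<bullet> h)\<close>, to the rank one part; those in which a coefficient is differentiated give
  \<open>score_deriv\<close>.
\<close>

lemma has_derivative_tilted_score:
  assumes W: "exp_integrable M Z W" and x: "x \<in> dom_v"
  shows "((\<lambda>y. \<integral>\<omega>. (W \<omega> * tilt y \<omega>) *\<^sub>R score y \<omega> \<partial>M) has_derivative
     (\<lambda>h. \<integral>\<omega>. (W \<omega> * tilt x \<omega>) *\<^sub>R (score_deriv x \<omega> h + (score x \<omega> \<bullet> h) *\<^sub>R score x \<omega>) \<partial>M)) (at x)"
  (is "(?g has_derivative ?H) (at x)")
proof (subst has_derivative_componentwise_within, rule ballI)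
  fix b :: "(real ^ 'd) \<times> (real ^ 'p)"
  let ?WG = "\<lambda>\<omega>. W \<omega> * (fst b \<bullet> G \<omega>)" and ?WN = "\<lambda>i \<omega>. W \<omega> * real (N \<omega> $ i)"
  let ?S = "\<lambda>W h. tilted_mean (\<lambda>\<omega>. W \<omega> * (score x \<omega> \<bullet> h)) x"
  have WG: "exp_integrable M Z ?WG" and WN: "exp_integrable M Z (?WN i)" for i
    by (rule exp_integrable_mult[OF W _ Z_measurable], rule exp_growth_G exp_growth_N)+
  \<comment> \<open>A combination of tilted expectations whose weights do not depend on \<open>y\<close>.\<close>
  have g: "?g y \<bullet> b = (fst y \<bullet> fst b + (\<Sum>i\<in>UNIV. snd b $ i)) * tilted_mean W y
     - tilted_mean ?WG y
     - (\<Sum>i\<in>UNIV. snd b $ i * inverse (snd y $ i) * tilted_mean (?WN i) y)" if "y \<in> dom_v" for y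
    unfolding inner_integral_tilt[OF W that exp_growth_score] by (rule tilted_mean_score[OF W that])
  have inv: "((\<lambda>y. inverse (snd y $ i)) has_derivative (\<lambda>h. - (snd h $ i / (snd x $ i)\<^sup>2))) (at x)" for i
    using snd_dom_v_pos[OF x, of i]
    by (auto intro!: derivative_eq_intros bounded_linear.has_derivative[OF bounded_linear_vec_nth]
        simp: field_simps power2_eq_square)
  have "((\<lambda>y. (fst y \<bullet> fst b + (\<Sum>i\<in>UNIV. snd b $ i)) * tilted_mean W y
     - tilted_mean ?WG y
     - (\<Sum>i\<in>UNIV. snd b $ i * inverse (snd y $ i) * tilted_mean (?WN i) y)) has_derivative
     (\<lambda>h. ((fst x \<bullet> fst b + (\<Sum>i\<in>UNIV. snd b $ i)) * ?S W h + (fst h \<bullet> fst b) * tilted_mean W x)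
       - ?S ?WG h
       - (\<Sum>i\<in>UNIV. snd b $ i * inverse (snd x $ i) * ?S (?WN i) h +
            (snd b $ i * (- (snd h $ i / (snd x $ i)\<^sup>2))) * tilted_mean (?WN i) x))) (at x)"
    by (intro has_derivative_diff has_derivative_sum has_derivative_mult has_derivative_mult_right inv
        has_derivative_tilted_mean[OF W x] has_derivative_tilted_mean[OF WG x] has_derivative_tilted_mean[OF WN x])
      (auto intro!: derivative_eq_intros)
  then have "((\<lambda>y. ?g y \<bullet> b) has_derivative
     (\<lambda>h. ((fst x \<bullet> fst b + (\<Sum>i\<in>UNIV. snd b $ i)) * ?S W h + (fst h \<bullet> fst b) * tilted_mean W x)
       - ?S ?WG h
       - (\<Sum>i\<in>UNIV. snd b $ i * inverse (snd x $ i) * ?S (?WN i) h +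
            (snd b $ i * (- (snd h $ i / (snd x $ i)\<^sup>2))) * tilted_mean (?WN i) x))) (at x)"
    by (rule has_derivative_transform_within_open[OF _ open_dom_v x]) (simp add: g)
  moreover have "((fst x \<bullet> fst b + (\<Sum>i\<in>UNIV. snd b $ i)) * ?S W h + (fst h \<bullet> fst b) * tilted_mean W x)
       - ?S ?WG h
       - (\<Sum>i\<in>UNIV. snd b $ i * inverse (snd x $ i) * ?S (?WN i) h +
            (snd b $ i * (- (snd h $ i / (snd x $ i)\<^sup>2))) * tilted_mean (?WN i) x) = ?H h \<bullet> b" for h
  proof -
    let ?V = "\<lambda>\<omega>. W \<omega> * (score x \<omega> \<bullet> h)"
    have V: "exp_integrable M Z ?V" by (rule exp_integrable_score[OF W])
    have D: "tilted_mean (\<lambda>\<omega>. W \<omega> * (score_deriv x \<omega> h \<bullet> b)) x =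
      (fst h \<bullet> fst b) * tilted_mean W x +
      (\<Sum>i\<in>UNIV. snd b $ i * snd h $ i / (snd x $ i)\<^sup>2 * tilted_mean (?WN i) x)"
    proof -
      have "W \<omega> * (score_deriv x \<omega> h \<bullet> b) * tilt x \<omega> = (fst h \<bullet> fst b) * (W \<omega> * tilt x \<omega>) +
        (\<Sum>i\<in>UNIV. snd b $ i * snd h $ i / (snd x $ i)\<^sup>2 * (W \<omega> * real (N \<omega> $ i) * tilt x \<omega>))" for \<omega>
        unfolding score_deriv_inner by (simp add: algebra_simps sum_distrib_left)
      then show ?thesis unfolding tilted_mean_def
        by (simp add: integrable_tilt[OF W x] integrable_tilt[OF WN x])
    qed
    have "?H h \<bullet> b = tilted_mean (\<lambda>\<omega>. W \<omega> * ((score_deriv x \<omega> h + (score x \<omega> \<bullet> h) *\<^sub>R score x \<omega>) \<bullet> b)) x"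
      by (rule inner_integral_tilt[OF W x])
        (intro exp_growth_add exp_growth_scaleR exp_growth_score exp_growth_score_inner exp_growth_score_deriv)
    also have "\<dots> = tilted_mean (\<lambda>\<omega>. W \<omega> * (score_deriv x \<omega> h \<bullet> b)) x + ?S ?V b"
    proof -
      have "integrable M (\<lambda>\<omega>. W \<omega> * (score_deriv x \<omega> h \<bullet> b) * tilt x \<omega>)"
        unfolding score_deriv_inner
        by (intro integrable_tilt_mult[OF W x] exp_growth_add exp_growth_sum exp_growth_mult exp_growth_const exp_growth_N)
      moreover have "integrable M (\<lambda>\<omega>. ?V \<omega> * (score x \<omega> \<bullet> b) * tilt x \<omega>)"
        by (rule integrable_tilt_mult[OF V x exp_growth_score_inner])
      ultimately show ?thesis
        unfolding tilted_mean_def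
        by (subst Bochner_Integration.integral_add[symmetric]) (auto simp: algebra_simps)
    qed
    finally show ?thesis
      unfolding D tilted_mean_score[OF V x]
      by (simp add: algebra_simps sum_subtractf sum.distrib sum_negf)
  qed
  ultimately show "((\<lambda>y. ?g y \<bullet> b) has_derivative (\<lambda>h. ?H h \<bullet> b)) (at x)" by simp
qed

lemma exp_growth_fst_score: "exp_growth M Z (\<lambda>\<omega>. \<theta> - G \<omega>)"
  using exp_growth_bounded_linear[OF bounded_linear_fst exp_growth_score[of "(\<theta>, 0)"]] by (simp add: score_def)

lemma exp_growth_snd_score: "exp_growth M Z (\<lambda>\<omega>. a_vec (N \<omega>) lam)"
  using exp_growth_bounded_linear[OF bounded_linear_snd exp_growth_score[of "(0, lam)"]] by (simp add: score_def)

lemma exp_growth_D_mat: "exp_growth M Z (\<lambda>\<omega>. D_mat (N \<omega>) lam)"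
proof (intro exp_growth_vec)
  fix i j
  have "exp_growth M Z (\<lambda>\<omega>. real (N \<omega> $ i) * (1 / (lam $ i)\<^sup>2))"
    by (intro exp_growth_mult exp_growth_const exp_growth_N)
  then show "exp_growth M Z (\<lambda>\<omega>. D_mat (N \<omega>) lam $ i $ j)"
    using exp_growth_const[of M Z "0 :: real"] by (cases "i = j") (simp_all add: D_mat_def)
qed

lemma integral_tilt_matrix_vector:
  fixes A :: "'w \<Rightarrow> real ^ 'n ^ 'm"
  assumes "exp_integrable M Z W" "x \<in> dom_v" "exp_growth M Z A"
  shows "(\<integral>\<omega>. (W \<omega> * tilt x \<omega>) *\<^sub>R A \<omega> \<partial>M) *v h = (\<integral>\<omega>. (W \<omega> * tilt x \<omega>) *\<^sub>R (A \<omega> *v h) \<partial>M)"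
proof -
  have "linear (\<lambda>A :: real ^ 'n ^ 'm. A *v h)"
    by (rule linearI) (simp_all add: matrix_vector_mult_add_rdistrib scaleR_matrix_vector_assoc)
  then have "bounded_linear (\<lambda>A :: real ^ 'n ^ 'm. A *v h)"
    by (simp add: linear_conv_bounded_linear)
  from integral_bounded_linear[OF this integrable_tilt_scaleR[OF assms]]
  show ?thesis by (simp add: scaleR_matrix_vector_assoc)
qed

lemma gderiv_tilted_mean:
  assumes W: "exp_integrable M Z W" and x: "x \<in> dom_v"
  shows "GDERIV (tilted_mean W) x :> (\<integral>\<omega>. (W \<omega> * tilt x \<omega>) *\<^sub>R score x \<omega> \<partial>M)"
  using has_derivative_tilted_mean[OF W x]
  unfolding gderiv_def inner_commute[of _ "integral\<^sup>L _ _"] inner_integral_tilt[OF W x exp_growth_score] .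

end

lemma outer_mult_vector: "outer x y *v h = (y \<bullet> h) *\<^sub>R x"
  by (simp add: outer_def matrix_vector_mult_def inner_vec_def vec_eq_iff sum_distrib_left mult_ac)

lemma gradient_eqI:
  assumes "GDERIV f x :> D"
  shows "gradient f x = D"
  unfolding gradient_def
proof (rule the_equality[where P = "\<lambda>D. GDERIV f x :> D", OF assms])
  fix E assume "GDERIV f x :> E"
  then have "(\<lambda>h. h \<bullet> E) = (\<lambda>h. h \<bullet> D)"
    using assms unfolding gderiv_def by (rule has_derivative_unique)
  then show "E = D" by (metis vector_eq_ldot)
qed

section \<open>Uniform positivity of the Hessian\<close>

lemma power_div_fact_le_exp:
  fixes x :: real
  assumes "0 \<le> x"
  shows "x ^ k / fact k \<le> exp x"
proof -
  have "(\<Sum>i\<in>{k}. x ^ i /\<^sub>R fact i) \<le> (\<Sum>i. x ^ i /\<^sub>R fact i)"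
    by (rule sum_le_suminf[OF summable_exp_generic]) (use assms in auto)
  then show ?thesis by (simp add: exp_def field_simps)
qed

context gauss_poisson_tilt
begin

text \<open>
  The bound is uniform in \<open>x\<close>. Completing the square in \<open>\<theta>\<close> gives the Gaussian factor. Coordinate by
  coordinate, both \<open>q\<^sub>i = exp (\<lambda>\<^sub>i - \<mu>\<^sub>i) (\<mu>\<^sub>i / \<lambda>\<^sub>i)\<^bsup>n\<^sub>i\<^esup>\<close> and \<open>q\<^sub>i n\<^sub>i / \<lambda>\<^sub>i\<^sup>2\<close> are at least
  \<open>k\<^sub>i = exp (- \<mu>\<^sub>i) \<mu>\<^sub>i\<^bsup>n\<^sub>i\<^esup> / (n\<^sub>i + 2)!\<close>. The first bound serves the directions in \<open>\<theta>\<close>, and the second one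
  the direction \<open>\<lambda>\<^sub>i\<close>, where the factor \<open>n\<^sub>i / \<lambda>\<^sub>i\<^sup>2\<close> alone would tend to \<open>0\<close> as \<open>\<lambda>\<^sub>i\<close> grows.
\<close>

lemma tilt_hessian_lower_bound:
  assumes n: "\<And>i. n $ i \<noteq> 0" and "N \<omega> = n" and x: "x \<in> dom_v"
  shows "(\<Prod>i\<in>UNIV. exp (- \<mu> $ i) * \<mu> $ i ^ (n $ i) / fact (n $ i + 2)) * exp (- (G \<omega> \<bullet> G \<omega>) / 2) * (h \<bullet> h)
    \<le> tilt x \<omega> * (score_deriv x \<omega> h \<bullet> h)"
proof -
  define q where "q i = exp (snd x $ i - \<mu> $ i) * (\<mu> $ i / snd x $ i) ^ (n $ i)" for i
  define k where "k i = exp (- \<mu> $ i) * \<mu> $ i ^ (n $ i) / fact (n $ i + 2)" for i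
  have l: "0 < snd x $ i" for i by (rule snd_dom_v_pos[OF x])
  have k_pos: "0 < k i" for i using mu_pos[of i] by (simp add: k_def)
  have q_eq: "q i = exp (- \<mu> $ i) * \<mu> $ i ^ (n $ i) * (exp (snd x $ i) / snd x $ i ^ (n $ i))" for i
    by (simp add: q_def exp_diff exp_minus power_divide field_simps)
  have kq: "k i \<le> q i" for i
  proof -
    have "1 / fact (n $ i + 2) \<le> 1 / (fact (n $ i) :: real)"
      by (intro divide_left_mono fact_mono) auto
    also have "\<dots> \<le> exp (snd x $ i) / snd x $ i ^ (n $ i)"
      using power_div_fact_le_exp[of "snd x $ i" "n $ i"] l[of i] by (simp add: field_simps)
    finally have "exp (- \<mu> $ i) * \<mu> $ i ^ (n $ i) * (1 / fact (n $ i + 2)) \<le>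
        exp (- \<mu> $ i) * \<mu> $ i ^ (n $ i) * (exp (snd x $ i) / snd x $ i ^ (n $ i))"
      using mu_pos[of i] by (intro mult_left_mono) auto
    then show ?thesis unfolding k_def q_eq by simp
  qed
  have kqN: "k i \<le> q i * (real (n $ i) / (snd x $ i)\<^sup>2)" for i
  proof -
    have "1 / fact (n $ i + 2) \<le> exp (snd x $ i) / snd x $ i ^ (n $ i + 2)"
      using power_div_fact_le_exp[of "snd x $ i" "n $ i + 2"] l[of i] by (simp add: field_simps del: fact_Suc)
    \<comment> \<open>Here \<open>n $ i \<noteq> 0\<close> enters: it gives \<open>1 \<le> real (n $ i)\<close>.\<close>
    also have "\<dots> \<le> exp (snd x $ i) / snd x $ i ^ (n $ i + 2) * real (n $ i)"
      using n[of i] l[of i] by (simp add: divide_right_mono)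
    also have "\<dots> = exp (snd x $ i) / snd x $ i ^ (n $ i) * (real (n $ i) / (snd x $ i)\<^sup>2)"
      by (simp add: power_add power2_eq_square)
    finally have "exp (- \<mu> $ i) * \<mu> $ i ^ (n $ i) * (1 / fact (n $ i + 2)) \<le>
        exp (- \<mu> $ i) * \<mu> $ i ^ (n $ i) * (exp (snd x $ i) / snd x $ i ^ (n $ i) * (real (n $ i) / (snd x $ i)\<^sup>2))"
      using mu_pos[of i] by (intro mult_left_mono) auto
    then show ?thesis unfolding k_def q_eq by (simp add: mult.assoc)
  qed
  have qk: "prod k UNIV \<le> prod q UNIV"
    using kq k_pos by (intro prod_mono) (auto intro: less_imp_le)
  have qkN: "prod k UNIV \<le> prod q UNIV * (real (n $ i) / (snd x $ i)\<^sup>2)" for i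
  proof -
    have nn: "0 \<le> q i * (real (n $ i) / (snd x $ i)\<^sup>2)" using k_pos[of i] kqN[of i] by (rule order.trans[OF less_imp_le])
    have "prod k UNIV = k i * prod k (UNIV - {i})" by (rule prod.remove) auto
    also have "\<dots> \<le> (q i * (real (n $ i) / (snd x $ i)\<^sup>2)) * prod q (UNIV - {i})"
      by (intro mult_mono prod_mono prod_nonneg kqN nn) (simp_all add: kq k_pos less_imp_le)
    also have "\<dots> = prod q UNIV * (real (n $ i) / (snd x $ i)\<^sup>2)"
      using prod.remove[of UNIV i q] by simp
    finally show ?thesis .
  qed
  have tilt: "tilt x \<omega> = exp (- (fst x \<bullet> G \<omega>) + (norm (fst x))\<^sup>2 / 2) * prod q UNIV"
    using assms(2) by (simp add: tilt_def q_def[abs_def])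
  have "0 \<le> (fst x - G \<omega>) \<bullet> (fst x - G \<omega>)" by simp
  then have "- (G \<omega> \<bullet> G \<omega>) / 2 \<le> - (fst x \<bullet> G \<omega>) + (norm (fst x))\<^sup>2 / 2"
    by (simp add: power2_norm_eq_inner inner_diff_left inner_diff_right inner_commute)
  then have e: "exp (- (G \<omega> \<bullet> G \<omega>) / 2) \<le> exp (- (fst x \<bullet> G \<omega>) + (norm (fst x))\<^sup>2 / 2)"
    by simp
  have sum_n: "score_deriv x \<omega> h \<bullet> h = fst h \<bullet> fst h + (\<Sum>i\<in>UNIV. real (n $ i) / (snd x $ i)\<^sup>2 * (snd h $ i)\<^sup>2)"
    unfolding score_deriv_inner assms(2) by (simp add: power2_eq_square mult_ac)
  have hh: "h \<bullet> h = fst h \<bullet> fst h + (\<Sum>i\<in>UNIV. (snd h $ i)\<^sup>2)"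
    by (cases h) (simp add: inner_vec_def[of "snd _"] inner_vec_def power2_eq_square)
  have "prod k UNIV * (h \<bullet> h) = prod k UNIV * (fst h \<bullet> fst h) + (\<Sum>i\<in>UNIV. prod k UNIV * (snd h $ i)\<^sup>2)"
    unfolding hh by (simp add: distrib_left sum_distrib_left)
  also have "\<dots> \<le> prod q UNIV * (fst h \<bullet> fst h) +
      (\<Sum>i\<in>UNIV. (prod q UNIV * (real (n $ i) / (snd x $ i)\<^sup>2)) * (snd h $ i)\<^sup>2)"
    by (intro add_mono sum_mono mult_right_mono qk qkN) auto
  also have "\<dots> = prod q UNIV * (score_deriv x \<omega> h \<bullet> h)"
    unfolding sum_n by (simp add: distrib_left sum_distrib_left mult_ac)
  finally have "prod k UNIV * (h \<bullet> h) \<le> prod q UNIV * (score_deriv x \<omega> h \<bullet> h)" .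
  moreover have "0 \<le> prod k UNIV * (h \<bullet> h)"
    using k_pos by (intro mult_nonneg_nonneg prod_nonneg) (simp_all add: less_imp_le)
  ultimately have "exp (- (G \<omega> \<bullet> G \<omega>) / 2) * (prod k UNIV * (h \<bullet> h)) \<le>
      exp (- (fst x \<bullet> G \<omega>) + (norm (fst x))\<^sup>2 / 2) * (prod q UNIV * (score_deriv x \<omega> h \<bullet> h))"
    by - (rule mult_mono[OF e], simp_all)
  then show ?thesis
    unfolding tilt k_def[abs_def] by (simp only: mult_ac)
qed

text \<open>
  Integrating the pointwise bound over the event \<open>N = n\<close>; off this event, and for the rank one part,
  nonnegativity is enough.
\<close>

lemma tilted_hessian_lower_bound:
  assumes W: "exp_integrable M Z W" and W_nonneg: "\<And>\<omega>. 0 \<le> W \<omega>"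
    and n: "\<And>i. n $ i \<noteq> 0" and pos: "\<not> (AE \<omega> in M. \<not> (N \<omega> = n \<and> W \<omega> \<noteq> 0))"
  obtains c where "0 < c" "\<And>x h. x \<in> dom_v \<Longrightarrow> c * (h \<bullet> h) \<le>
    (\<integral>\<omega>. (W \<omega> * tilt x \<omega>) *\<^sub>R (score_deriv x \<omega> h + (score x \<omega> \<bullet> h) *\<^sub>R score x \<omega>) \<partial>M) \<bullet> h"
proof -
  define k where "k = (\<Prod>i\<in>UNIV. exp (- \<mu> $ i) * \<mu> $ i ^ (n $ i) / fact (n $ i + 2))"
  define R where "R \<omega> = W \<omega> * (indicator {\<omega>. N \<omega> = n} \<omega> * exp (- (G \<omega> \<bullet> G \<omega>) / 2))" for \<omega>
  have [measurable]: "{\<omega>. N \<omega> = n} \<inter> space M \<in> sets M"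
    using measurable_sets[OF N_measurable, of "{n}"] by (simp add: vimage_def Int_def)
  have growth: "exp_growth M Z (\<lambda>\<omega>. indicator {\<omega>. N \<omega> = n} \<omega> * exp (- (G \<omega> \<bullet> G \<omega>) / 2) :: real)"
    by (rule exp_growthI[of _ _ 1 0]) (auto split: split_indicator)
  have iR: "integrable M R"
    using integrable_exp_growth[OF W growth] by (simp add: R_def[abs_def])
  have R_nonneg: "0 \<le> R \<omega>" for \<omega> using W_nonneg by (simp add: R_def)
  have "(\<integral>\<omega>. R \<omega> \<partial>M) \<noteq> 0"
  proof
    assume "(\<integral>\<omega>. R \<omega> \<partial>M) = 0"
    then have "AE \<omega> in M. R \<omega> = 0"
      using integral_nonneg_eq_0_iff_AE[OF iR] R_nonneg by simp
    then have "AE \<omega> in M. \<not> (N \<omega> = n \<and> W \<omega> \<noteq> 0)"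
      by eventually_elim (auto simp: R_def)
    with pos show False by simp
  qed
  moreover have "0 \<le> (\<integral>\<omega>. R \<omega> \<partial>M)"
    using R_nonneg by (intro integral_nonneg_AE AE_I2)
  ultimately have R_pos: "0 < (\<integral>\<omega>. R \<omega> \<partial>M)" by simp
  have k_pos: "0 < k" unfolding k_def using mu_pos by (intro prod_pos) auto
  show thesis
  proof (rule that[of "k * (\<integral>\<omega>. R \<omega> \<partial>M)"])
    show "0 < k * (\<integral>\<omega>. R \<omega> \<partial>M)" using k_pos R_pos by simp
    fix x :: "(real ^ 'd) \<times> (real ^ 'p)" and h
    assume x: "x \<in> dom_v"
    let ?Y = "\<lambda>\<omega>. score_deriv x \<omega> h + (score x \<omega> \<bullet> h) *\<^sub>R score x \<omega>"
    have Y: "exp_growth M Z ?Y"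
      by (intro exp_growth_add exp_growth_scaleR exp_growth_score exp_growth_score_inner exp_growth_score_deriv)
    have "k * (\<integral>\<omega>. R \<omega> \<partial>M) * (h \<bullet> h) = (\<integral>\<omega>. (k * (h \<bullet> h)) * R \<omega> \<partial>M)"
      by simp
    also have "\<dots> \<le> (\<integral>\<omega>. W \<omega> * (?Y \<omega> \<bullet> h) * tilt x \<omega> \<partial>M)"
    proof (rule integral_mono)
      show "integrable M (\<lambda>\<omega>. (k * (h \<bullet> h)) * R \<omega>)" using iR by simp
      show "integrable M (\<lambda>\<omega>. W \<omega> * (?Y \<omega> \<bullet> h) * tilt x \<omega>)"
        by (intro integrable_tilt_mult[OF W x] exp_growth_bounded_linear[OF bounded_linear_inner_left Y])
      fix \<omega>
      have sq: "?Y \<omega> \<bullet> h = score_deriv x \<omega> h \<bullet> h + (score x \<omega> \<bullet> h)\<^sup>2"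
        by (simp add: inner_add_left power2_eq_square)
      have dn: "0 \<le> score_deriv x \<omega> h \<bullet> h"
        unfolding score_deriv_inner by (intro add_nonneg_nonneg inner_ge_zero sum_nonneg
              mult_nonneg_nonneg[OF divide_nonneg_nonneg[OF zero_le_square]]) auto
      have "(k * (h \<bullet> h)) * R \<omega> \<le> W \<omega> * (tilt x \<omega> * (score_deriv x \<omega> h \<bullet> h))"
      proof (cases "N \<omega> = n")
        case True
        have "W \<omega> * (k * exp (- (G \<omega> \<bullet> G \<omega>) / 2) * (h \<bullet> h)) \<le> W \<omega> * (tilt x \<omega> * (score_deriv x \<omega> h \<bullet> h))"
          unfolding k_def by (rule mult_left_mono[OF tilt_hessian_lower_bound[OF n True x] W_nonneg])
        then show ?thesis using True by (simp add: R_def mult_ac)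
      next
        case False
        then show ?thesis using dn W_nonneg[of \<omega>] tilt_pos[OF x, of \<omega>] by (simp add: R_def)
      qed
      also have "\<dots> \<le> W \<omega> * (tilt x \<omega> * (?Y \<omega> \<bullet> h))"
        unfolding sq using W_nonneg[of \<omega>] tilt_pos[OF x, of \<omega>]
        by (intro mult_left_mono) auto
      finally show "(k * (h \<bullet> h)) * R \<omega> \<le> W \<omega> * (?Y \<omega> \<bullet> h) * tilt x \<omega>" by (simp add: mult_ac)
    qed
    also have "\<dots> = (\<integral>\<omega>. (W \<omega> * tilt x \<omega>) *\<^sub>R ?Y \<omega> \<partial>M) \<bullet> h"
      unfolding inner_integral_tilt[OF W x Y] tilted_mean_def ..
    finally show "k * (\<integral>\<omega>. R \<omega> \<partial>M) * (h \<bullet> h) \<le> (\<integral>\<omega>. (W \<omega> * tilt x \<omega>) *\<^sub>R ?Y \<omega> \<partial>M) \<bullet> h" .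
  qed
qed

end

section \<open>Exponential moments of Gaussian and Poisson vectors\<close>

text \<open>
  A form of Young's inequality, by comparing \<open>E\<close> with \<open>\<bar>y\<bar>\<^bsup>\<gamma>\<^esup>\<close>: whichever of the two is larger bounds the
  left side by the corresponding term on the right.
\<close>

lemma square_mult_le_powr:
  fixes y E \<gamma> :: real
  assumes "0 < \<gamma>" "0 < E"
  shows "y\<^sup>2 * E \<le> \<bar>y\<bar> powr (2 + \<gamma>) + E powr ((2 + \<gamma>) / \<gamma>)"
proof (cases "E \<le> \<bar>y\<bar> powr \<gamma>")
  case True
  then have "y \<noteq> 0" using assms by auto
  have "y\<^sup>2 * E \<le> \<bar>y\<bar> powr 2 * \<bar>y\<bar> powr \<gamma>"
    using True \<open>y \<noteq> 0\<close> by (simp add: mult_left_mono)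
  also have "\<dots> = \<bar>y\<bar> powr (2 + \<gamma>)" by (simp add: powr_add)
  finally show ?thesis using powr_ge_zero[of E "(2 + \<gamma>) / \<gamma>"] by linarith
next
  case False
  have "\<bar>y\<bar> = (\<bar>y\<bar> powr \<gamma>) powr (1 / \<gamma>)" using assms by (simp add: powr_powr)
  also have "\<dots> \<le> E powr (1 / \<gamma>)" using False assms by (intro powr_mono2) auto
  finally have "\<bar>y\<bar>\<^sup>2 \<le> (E powr (1 / \<gamma>))\<^sup>2" by (intro power_mono) auto
  then have "y\<^sup>2 * E \<le> (E powr (1 / \<gamma>))\<^sup>2 * E" using assms by (intro mult_right_mono) auto
  also have "\<dots> = E powr (1 / \<gamma> + 1 / \<gamma> + 1)"
    unfolding powr_add power2_eq_square using assms by simp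
  also have "1 / \<gamma> + 1 / \<gamma> + 1 = (2 + \<gamma>) / \<gamma>" using assms by (simp add: field_simps)
  finally show ?thesis using powr_ge_zero[of "\<bar>y\<bar>" "2 + \<gamma>"] by linarith
qed

lemma exp_integrable_square:
  fixes X :: "'w \<Rightarrow> real" and Z :: "'w \<Rightarrow> 'z::euclidean_space"
  assumes [measurable]: "X \<in> borel_measurable M" "Z \<in> borel_measurable M"
    and "0 < \<gamma>" "integrable M (\<lambda>\<omega>. \<bar>X \<omega>\<bar> powr (2 + \<gamma>))"
    and Z: "\<And>c. integrable M (\<lambda>\<omega>. exp (c * norm (Z \<omega>)))"
  shows "exp_integrable M Z (\<lambda>\<omega>. (X \<omega>)\<^sup>2)"
  unfolding exp_integrable_def
proof (intro conjI allI)
  fix c :: real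
  let ?q = "(2 + \<gamma>) / \<gamma>"
  show "integrable M (\<lambda>\<omega>. (X \<omega>)\<^sup>2 * exp (c * norm (Z \<omega>)))"
  proof (rule Bochner_Integration.integrable_bound)
    show "integrable M (\<lambda>\<omega>. \<bar>X \<omega>\<bar> powr (2 + \<gamma>) + exp ((c * ?q) * norm (Z \<omega>)))"
      using assms(4) Z by (rule Bochner_Integration.integrable_add)
    show "AE \<omega> in M. norm ((X \<omega>)\<^sup>2 * exp (c * norm (Z \<omega>))) \<le>
        norm (\<bar>X \<omega>\<bar> powr (2 + \<gamma>) + exp ((c * ?q) * norm (Z \<omega>)))"
    proof (rule AE_I2)
      fix \<omega>
      have "exp (c * norm (Z \<omega>)) powr ?q = exp ((c * ?q) * norm (Z \<omega>))"
        by (simp add: powr_def mult_ac)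
      with square_mult_le_powr[OF assms(3), of "exp (c * norm (Z \<omega>))" "X \<omega>"]
      show "norm ((X \<omega>)\<^sup>2 * exp (c * norm (Z \<omega>))) \<le>
          norm (\<bar>X \<omega>\<bar> powr (2 + \<gamma>) + exp ((c * ?q) * norm (Z \<omega>)))"
        by (simp add: abs_of_nonneg add_nonneg_nonneg)
    qed
  qed measurable
qed measurable

text \<open>
  Replacing every summand of the exponent by the largest one reduces a joint exponential moment to
  marginal ones.
\<close>

lemma exp_sum_le_sum_exp:
  fixes t :: "'i \<Rightarrow> real"
  assumes "finite I" "I \<noteq> {}"
  shows "exp (\<Sum>i\<in>I. t i) \<le> (\<Sum>i\<in>I. exp (real (card I) * t i))"
proof -
  have "Max (t ` I) \<in> t ` I" using assms by (intro Max_in) auto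
  then obtain j where j: "j \<in> I" "Max (t ` I) = t j" by (metis imageE)
  have le: "t i \<le> t j" if "i \<in> I" for i
    using Max_ge[of "t ` I" "t i"] assms that j(2) by simp
  have "exp (\<Sum>i\<in>I. t i) \<le> exp (real (card I) * t j)"
    using sum_bounded_above[of I t "t j"] le by simp
  also have "\<dots> \<le> (\<Sum>i\<in>I. exp (real (card I) * t i))"
    using j(1) assms(1) by (intro member_le_sum) auto
  finally show ?thesis .
qed

lemma integrable_exp_norm:
  fixes Z :: "'w \<Rightarrow> 'z::euclidean_space"
  assumes [measurable]: "Z \<in> borel_measurable M"
    and "\<And>b c. b \<in> Basis \<Longrightarrow> integrable M (\<lambda>\<omega>. exp (c * \<bar>Z \<omega> \<bullet> b\<bar>))"
  shows "integrable M (\<lambda>\<omega>. exp (c * norm (Z \<omega>)))"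
proof (rule Bochner_Integration.integrable_bound)
  let ?m = "real (card (Basis :: 'z set))"
  show "integrable M (\<lambda>\<omega>. \<Sum>b\<in>Basis. exp ((?m * \<bar>c\<bar>) * \<bar>Z \<omega> \<bullet> b\<bar>))"
    by (intro Bochner_Integration.integrable_sum assms(2))
  show "AE \<omega> in M. norm (exp (c * norm (Z \<omega>))) \<le> norm (\<Sum>b\<in>Basis. exp ((?m * \<bar>c\<bar>) * \<bar>Z \<omega> \<bullet> b\<bar>))"
  proof (rule AE_I2)
    fix \<omega>
    have "c * norm (Z \<omega>) \<le> \<bar>c\<bar> * (\<Sum>b\<in>Basis. \<bar>Z \<omega> \<bullet> b\<bar>)"
      using norm_le_l1[of "Z \<omega>"] by (intro mult_mono) auto
    then have "exp (c * norm (Z \<omega>)) \<le> exp (\<Sum>b\<in>Basis. \<bar>c\<bar> * \<bar>Z \<omega> \<bullet> b\<bar>)"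
      by (simp add: sum_distrib_left)
    also have "\<dots> \<le> (\<Sum>b\<in>Basis. exp (?m * (\<bar>c\<bar> * \<bar>Z \<omega> \<bullet> b\<bar>)))"
      by (rule exp_sum_le_sum_exp) auto
    finally show "norm (exp (c * norm (Z \<omega>))) \<le> norm (\<Sum>b\<in>Basis. exp ((?m * \<bar>c\<bar>) * \<bar>Z \<omega> \<bullet> b\<bar>))"
      by (simp add: mult.assoc abs_of_nonneg sum_nonneg)
  qed
qed measurable

text \<open>
  Completing the square turns \<open>exp (a x)\<close> times the standard normal density into a multiple of the
  normal density with mean \<open>a\<close>.
\<close>

lemma integrable_exp_std_normal:
  assumes "distributed M lborel X std_normal_density"
  shows "integrable M (\<lambda>\<omega>. exp (c * \<bar>X \<omega>\<bar>))"
proof -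
  have X[measurable]: "X \<in> borel_measurable M"
    using distributed_measurable[OF assms] by simp
  have e: "integrable M (\<lambda>\<omega>. exp (a * X \<omega>))" for a
  proof -
    have "std_normal_density x * exp (a * x) = exp (a\<^sup>2 / 2) * normal_density a 1 x" for x
    proof -
      have "- x\<^sup>2 / 2 + a * x = a\<^sup>2 / 2 + - (x - a)\<^sup>2 / 2" by (simp add: power2_eq_square field_simps)
      then show ?thesis by (simp add: normal_density_def exp_add[symmetric])
    qed
    then have "integrable lborel (\<lambda>x. std_normal_density x * exp (a * x))"
      by simp
    then show ?thesis
      using distributed_integrable[OF assms, of "\<lambda>x. exp (a * x)"] by simp
  qed
  show ?thesis
  proof (rule Bochner_Integration.integrable_bound)
    show "integrable M (\<lambda>\<omega>. exp (c * X \<omega>) + exp (- c * X \<omega>))"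
      by (intro Bochner_Integration.integrable_add e)
    have "exp (c * \<bar>y\<bar>) \<le> exp (c * y) + exp (- c * y)" for y
      by (cases "0 \<le> y") auto
    then show "AE \<omega> in M. norm (exp (c * \<bar>X \<omega>\<bar>)) \<le> norm (exp (c * X \<omega>) + exp (- c * X \<omega>))"
      by (auto simp: abs_of_nonneg add_nonneg_nonneg)
  qed measurable
qed

lemma integrable_exp_poisson:
  assumes "0 < r" "K \<in> measurable M (count_space UNIV)"
    and "distr M (count_space UNIV) K = measure_pmf (poisson_pmf r)"
  shows "integrable M (\<lambda>\<omega>. exp (c * real (K \<omega>)))"
proof -
  have "summable (\<lambda>k. exp (- r) * ((r * exp c) ^ k /\<^sub>R fact k))"
    by (intro summable_mult summable_exp_generic)
  then have "summable (\<lambda>k. norm (pmf (poisson_pmf r) k *\<^sub>R exp (c * real k)))"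
    using assms(1)
    by (simp add: power_mult_distrib exp_of_nat_mult[symmetric] abs_mult field_simps)
  then have "integrable (measure_pmf (poisson_pmf r)) (\<lambda>k. exp (c * real k))"
    by (simp add: measure_pmf_eq_density integrable_density integrable_count_space_nat_iff)
  then show ?thesis
    using integrable_distr_eq[OF assms(2), of "\<lambda>k. exp (c * real k)"] assms(3) by simp
qed

section \<open>Joint law of the Gaussian and Poisson vectors\<close>

lemma (in prob_space) poisson_vector_prob_pos:
  assumes "poisson_vector \<mu> N" "\<And>i. 0 < \<mu> $ i"
  shows "0 < prob {\<omega> \<in> space M. N \<omega> = n}"
proof -
  have ind: "indep_vars (\<lambda>_. count_space UNIV) (\<lambda>i \<omega>. N \<omega> $ i) UNIV"
    and d: "\<And>i. distr M (count_space UNIV) (\<lambda>\<omega>. N \<omega> $ i) = measure_pmf (poisson_pmf (\<mu> $ i))"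
    using assms(1) by (auto simp: poisson_vector_def)
  have m: "(\<lambda>\<omega>. N \<omega> $ i) \<in> measurable M (count_space UNIV)" for i
    using ind unfolding indep_vars_def2 by auto
  have pos: "0 < prob ((\<lambda>\<omega>. N \<omega> $ i) -` {n $ i} \<inter> space M)" for i
  proof -
    have "prob ((\<lambda>\<omega>. N \<omega> $ i) -` {n $ i} \<inter> space M) =
        measure (distr M (count_space UNIV) (\<lambda>\<omega>. N \<omega> $ i)) {n $ i}"
      by (subst measure_distr[OF m]) auto
    also have "\<dots> = pmf (poisson_pmf (\<mu> $ i)) (n $ i)"
      unfolding d by (simp add: measure_pmf_single)
    also have "\<dots> > 0" using assms(2)[of i] by simp
    finally show ?thesis .
  qed
  have "{\<omega> \<in> space M. N \<omega> = n} = (\<Inter>i\<in>UNIV. (\<lambda>\<omega>. N \<omega> $ i) -` {n $ i} \<inter> space M)"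
    by (auto simp: vec_eq_iff)
  also have "prob \<dots> = (\<Prod>i\<in>UNIV. prob ((\<lambda>\<omega>. N \<omega> $ i) -` {n $ i} \<inter> space M))"
    by (rule indep_varsD_finite[OF ind]) auto
  also have "\<dots> > 0" using pos by (intro prod_pos) auto
  finally show ?thesis .
qed

lemma (in prob_space) indep_rv_prob:
  assumes "indep_rv A X B Y" "S \<in> sets A" "T \<in> sets B"
  shows "prob {\<omega> \<in> space M. X \<omega> \<in> S \<and> Y \<omega> \<in> T} =
    prob {\<omega> \<in> space M. X \<omega> \<in> S} * prob {\<omega> \<in> space M. Y \<omega> \<in> T}"
proof -
  have "indep_set (sets (vimage_algebra (space M) X A)) (sets (vimage_algebra (space M) Y B))"
    using assms(1) by (simp add: indep_rv_def)
  from indep_setD[OF this in_vimage_algebra[OF assms(2)] in_vimage_algebra[OF assms(3)]]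
  show ?thesis by (simp add: vimage_def Int_def conj_ac cong: conj_cong)
qed

section \<open>Smoothness and strong convexity of the second moment\<close>

theorem proposition2p1:
  fixes M :: "'w measure"
    and G :: "'w \<Rightarrow> real ^ 'd"
    and N :: "'w \<Rightarrow> nat ^ 'p"
    and \<mu> :: "real ^ 'p"
    and f :: "real ^ 'd \<Rightarrow> nat ^ 'p \<Rightarrow> real"
    and v :: "(real ^ 'd) \<times> (real ^ 'p) \<Rightarrow> real"
    and F :: "real ^ 'd \<Rightarrow> real ^ 'd \<Rightarrow> nat ^ 'p \<Rightarrow> real ^ 'p \<Rightarrow> real"
  assumes "prob_space M"
    and "\<And>i. 0 < \<mu> $ i"
    and "prob_space.std_normal_vector M G"
    and "prob_space.poisson_vector M \<mu> N"
    and "prob_space.indep_rv M borel G (count_space UNIV) N"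
    and "(\<lambda>(g, n). f g n) \<in> borel_measurable (borel \<Otimes>\<^sub>M count_space UNIV)"
    and "integrable M (\<lambda>\<omega>. \<bar>f (G \<omega>) (N \<omega>)\<bar>)"
    and "\<exists>n. (\<forall>i. n $ i \<noteq> 0) \<and> measure M {\<omega> \<in> space M. \<bar>f (G \<omega>) n\<bar> > 0} > 0"
    and "\<exists>\<gamma>>0. integrable M (\<lambda>\<omega>. \<bar>f (G \<omega>) (N \<omega>)\<bar> powr (2 + \<gamma>))"
    and "v = prob_space.v_fun M G N f \<mu>"
    and "F = F_fun f \<mu>"
  shows
    "smooth_on v dom_v \<and>
     strongly_convex_on v dom_v \<and>
     (\<forall>\<theta> lam. (\<theta>, lam) \<in> dom_v \<longrightarrow>
        integrable M (\<lambda>\<omega>. F (G \<omega>) \<theta> (N \<omega>) lam) \<and>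
        integrable M (\<lambda>\<omega>. F (G \<omega>) \<theta> (N \<omega>) lam *\<^sub>R (\<theta> - G \<omega>)) \<and>
        GDERIV (\<lambda>t. v (t, lam)) \<theta> :>
          (\<integral>\<omega>. F (G \<omega>) \<theta> (N \<omega>) lam *\<^sub>R (\<theta> - G \<omega>) \<partial>M) \<and>
        integrable M (\<lambda>\<omega>. F (G \<omega>) \<theta> (N \<omega>) lam *\<^sub>R a_vec (N \<omega>) lam) \<and>
        GDERIV (\<lambda>l. v (\<theta>, l)) lam :>
          (\<integral>\<omega>. F (G \<omega>) \<theta> (N \<omega>) lam *\<^sub>R a_vec (N \<omega>) lam \<partial>M) \<and>
        integrable M (\<lambda>\<omega>. F (G \<omega>) \<theta> (N \<omega>) lam *\<^sub>R
          (mat 1 + outer (\<theta> - G \<omega>) (\<theta> - G \<omega>))) \<and>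
        ((\<lambda>t. gradient (\<lambda>t'. v (t', lam)) t) has_derivative
          (*v) (\<integral>\<omega>. F (G \<omega>) \<theta> (N \<omega>) lam *\<^sub>R
            (mat 1 + outer (\<theta> - G \<omega>) (\<theta> - G \<omega>)) \<partial>M)) (at \<theta>) \<and>
        integrable M (\<lambda>\<omega>. F (G \<omega>) \<theta> (N \<omega>) lam *\<^sub>R
          outer (\<theta> - G \<omega>) (a_vec (N \<omega>) lam)) \<and>
        ((\<lambda>l. gradient (\<lambda>t. v (t, l)) \<theta>) has_derivative
          (*v) (\<integral>\<omega>. F (G \<omega>) \<theta> (N \<omega>) lam *\<^sub>R
            outer (\<theta> - G \<omega>) (a_vec (N \<omega>) lam) \<partial>M)) (at lam) \<and>
        integrable M (\<lambda>\<omega>. F (G \<omega>) \<theta> (N \<omega>) lam *\<^sub>R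
          (D_mat (N \<omega>) lam + outer (a_vec (N \<omega>) lam) (a_vec (N \<omega>) lam))) \<and>
        ((\<lambda>l. gradient (\<lambda>l'. v (\<theta>, l')) l) has_derivative
          (*v) (\<integral>\<omega>. F (G \<omega>) \<theta> (N \<omega>) lam *\<^sub>R
            (D_mat (N \<omega>) lam + outer (a_vec (N \<omega>) lam) (a_vec (N \<omega>) lam)) \<partial>M)) (at lam))"
proof -
  interpret prob_space M by fact
  note mu = assms(2) and f_meas = assms(6)
  have G_meas: "G \<in> borel_measurable M" and N_meas: "N \<in> measurable M (count_space UNIV)"
    using assms(5) by (auto simp: indep_rv_def)
  interpret gauss_poisson_tilt M G N \<mu>
    by unfold_locales (fact mu G_meas N_meas)+

  let ?X = "\<lambda>\<omega>. f (G \<omega>) (N \<omega>)"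
  define W where "W \<omega> = (?X \<omega>)\<^sup>2" for \<omega>
  have X_meas: "?X \<in> borel_measurable M"
    using measurable_compose[OF measurable_Pair[OF G_meas N_meas] f_meas] by simp
  have moments: "integrable M (\<lambda>\<omega>. exp (c * norm (Z \<omega>)))" for c
  proof (rule integrable_exp_norm[OF Z_measurable])
    fix b :: "(real ^ 'd) \<times> (real ^ 'p)" and c :: real assume "b \<in> Basis"
    then consider i where "b = (axis i 1, 0)" | i where "b = (0, axis i 1)"
      by (auto simp: Basis_prod_def Basis_vec_def)
    then show "integrable M (\<lambda>\<omega>. exp (c * \<bar>Z \<omega> \<bullet> b\<bar>))"
    proof cases
      case 1
      then show ?thesis
        using integrable_exp_std_normal[of M "\<lambda>\<omega>. G \<omega> $ i"] assms(3)
        by (simp add: Z_def inner_axis std_normal_vector_def)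
    next
      case 2
      have "(\<lambda>\<omega>. N \<omega> $ i) \<in> measurable M (count_space UNIV)"
        using measurable_compose[OF N_meas] by simp
      with 2 show ?thesis
        using integrable_exp_poisson[OF mu[of i], of "\<lambda>\<omega>. N \<omega> $ i" M] assms(4)
        by (simp add: Z_def inner_axis poisson_vector_def)
    qed
  qed
  obtain \<gamma> where "0 < \<gamma>" "integrable M (\<lambda>\<omega>. \<bar>?X \<omega>\<bar> powr (2 + \<gamma>))"
    using assms(9) by blast
  then have W: "exp_integrable M Z W"
    unfolding W_def[abs_def] by (intro exp_integrable_square[OF X_meas Z_measurable _ _ moments])
  have W_nonneg: "0 \<le> W \<omega>" for \<omega> by (simp add: W_def)

  have F_eq: "F (G \<omega>) \<theta> (N \<omega>) lam = W \<omega> * tilt (\<theta>, lam) \<omega>" for \<omega> \<theta> lam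
    by (simp add: assms(11) F_fun_def W_def tilt_def mult.assoc)
  have v_eq: "v = tilted_mean W"
    by (simp add: fun_eq_iff assms(10) v_fun_def tilted_mean_def F_eq[unfolded assms(11)])

  define g where "g x = (\<integral>\<omega>. (W \<omega> * tilt x \<omega>) *\<^sub>R score x \<omega> \<partial>M)" for x
  define H where "H x h = (\<integral>\<omega>. (W \<omega> * tilt x \<omega>) *\<^sub>R
      (score_deriv x \<omega> h + (score x \<omega> \<bullet> h) *\<^sub>R score x \<omega>) \<partial>M)" for x h
  have v_g: "GDERIV v x :> g x" if "x \<in> dom_v" for x
    unfolding v_eq g_def by (rule gderiv_tilted_mean[OF W that])
  have g_H: "(g has_derivative H x) (at x)" if "x \<in> dom_v" for x
    unfolding g_def[abs_def] H_def[abs_def] by (rule has_derivative_tilted_score[OF W that])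

  have smooth: "smooth_on v dom_v"
    unfolding smooth_on_def v_eq by (intro conjI allI open_dom_v Ck_on_tilted_mean W)

  have convex: "strongly_convex_on v dom_v"
  proof -
    obtain n where n: "\<And>i. n $ i \<noteq> 0" and fn: "0 < prob {\<omega> \<in> space M. \<bar>f (G \<omega>) n\<bar> > 0}"
      using assms(8) by blast
    have f_n: "(\<lambda>g. f g n) \<in> borel_measurable borel"
      using measurable_compose[OF measurable_Pair[OF measurable_ident_sets[OF refl] measurable_const] f_meas, of n]
      by simp
    then have S: "{g. f g n \<noteq> 0} \<in> sets borel"
      by measurable
    have "prob {\<omega> \<in> space M. G \<omega> \<in> {g. f g n \<noteq> 0} \<and> N \<omega> \<in> {n}} =
        prob {\<omega> \<in> space M. \<bar>f (G \<omega>) n\<bar> > 0} * prob {\<omega> \<in> space M. N \<omega> = n}"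
      using indep_rv_prob[OF assms(5) S, of "{n}"] by simp
    also have "\<dots> > 0"
      using fn poisson_vector_prob_pos[OF assms(4) mu] by simp
    finally have pos: "0 < prob {\<omega> \<in> space M. f (G \<omega>) n \<noteq> 0 \<and> N \<omega> = n}" by simp
    have "\<not> (AE \<omega> in M. \<not> (N \<omega> = n \<and> W \<omega> \<noteq> 0))"
    proof
      assume "AE \<omega> in M. \<not> (N \<omega> = n \<and> W \<omega> \<noteq> 0)"
      then have "AE \<omega> in M. \<omega> \<notin> {\<omega> \<in> space M. f (G \<omega>) n \<noteq> 0 \<and> N \<omega> = n}"
        by eventually_elim (auto simp: W_def)
      moreover have "{\<omega> \<in> space M. f (G \<omega>) n \<noteq> 0 \<and> N \<omega> = n} \<in> events"
        using pos measure_notin_sets[of "{\<omega> \<in> space M. f (G \<omega>) n \<noteq> 0 \<and> N \<omega> = n}" M] by fastforce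
      ultimately show False
        using pos prob_eq_0[of "{\<omega> \<in> space M. f (G \<omega>) n \<noteq> 0 \<and> N \<omega> = n}"] by simp
    qed
    from tilted_hessian_lower_bound[OF W W_nonneg n this]
    obtain c where c: "0 < c" "\<And>x h. x \<in> dom_v \<Longrightarrow> c * (h \<bullet> h) \<le> H x h \<bullet> h"
      unfolding H_def by blast
    have "(gradient v has_derivative H x) (at x)" if "x \<in> dom_v" for x
      by (rule has_derivative_transform_within_open[OF g_H[OF that] open_dom_v that])
        (rule gradient_eqI[OF v_g, symmetric])
    moreover have "v differentiable (at x)" if "x \<in> dom_v" for x
      using v_g[OF that] unfolding gderiv_def differentiable_def by blast
    ultimately show ?thesis
      unfolding strongly_convex_on_def using open_dom_v convex_dom_v c by blast
  qed

  \<comment> \<open>The partial gradients are the two components of the full gradient \<open>g\<close>.\<close>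
  have grad_t: "GDERIV (\<lambda>t. v (t, lam)) \<theta> :> fst (g (\<theta>, lam))" if "(\<theta>, lam) \<in> dom_v" for \<theta> lam
  proof -
    have "((\<lambda>t. (t, lam)) has_derivative (\<lambda>h. (h, 0))) (at \<theta>)"
      by (intro derivative_intros)
    from has_derivative_compose[OF this v_g[OF that, unfolded gderiv_def]]
    show ?thesis by (simp add: gderiv_def inner_prod_def)
  qed
  have grad_l: "GDERIV (\<lambda>l. v (\<theta>, l)) lam :> snd (g (\<theta>, lam))" if "(\<theta>, lam) \<in> dom_v" for \<theta> lam
  proof -
    have "((\<lambda>l. (\<theta>, l)) has_derivative (\<lambda>h. (0, h))) (at lam)"
      by (intro derivative_intros)
    from has_derivative_compose[OF this v_g[OF that, unfolded gderiv_def]]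
    show ?thesis by (simp add: gderiv_def inner_prod_def)
  qed

  show ?thesis
  proof (intro conjI smooth convex allI impI; (unfold F_eq)?)
    fix \<theta> :: "real ^ 'd" and lam :: "real ^ 'p"
    assume x: "(\<theta>, lam) \<in> dom_v"
    let ?E = "\<lambda>\<omega>. W \<omega> * tilt (\<theta>, lam) \<omega>"
    note int = integrable_tilt_scaleR[OF W x]
    note grow_t = exp_growth_fst_score[of \<theta>] and grow_l = exp_growth_snd_score[of lam]
    note grow_tt = exp_growth_add[OF exp_growth_const[of M Z "mat 1"] exp_growth_outer[OF grow_t grow_t]]
      and grow_tl = exp_growth_outer[OF grow_t grow_l]
      and grow_ll = exp_growth_add[OF exp_growth_D_mat[of lam] exp_growth_outer[OF grow_l grow_l]]
    show "integrable M ?E" by (rule integrable_tilt[OF W x])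
    show "integrable M (\<lambda>\<omega>. ?E \<omega> *\<^sub>R (\<theta> - G \<omega>))" by (rule int[OF grow_t])
    show "integrable M (\<lambda>\<omega>. ?E \<omega> *\<^sub>R a_vec (N \<omega>) lam)" by (rule int[OF grow_l])
    show "integrable M (\<lambda>\<omega>. ?E \<omega> *\<^sub>R (mat 1 + outer (\<theta> - G \<omega>) (\<theta> - G \<omega>)))" by (rule int[OF grow_tt])
    show "integrable M (\<lambda>\<omega>. ?E \<omega> *\<^sub>R outer (\<theta> - G \<omega>) (a_vec (N \<omega>) lam))" by (rule int[OF grow_tl])
    show "integrable M (\<lambda>\<omega>. ?E \<omega> *\<^sub>R (D_mat (N \<omega>) lam + outer (a_vec (N \<omega>) lam) (a_vec (N \<omega>) lam)))"
      by (rule int[OF grow_ll])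

    have fst_int: "fst (\<integral>\<omega>. ?E \<omega> *\<^sub>R Y \<omega> \<partial>M) = (\<integral>\<omega>. ?E \<omega> *\<^sub>R fst (Y \<omega>) \<partial>M)"
      and snd_int: "snd (\<integral>\<omega>. ?E \<omega> *\<^sub>R Y \<omega> \<partial>M) = (\<integral>\<omega>. ?E \<omega> *\<^sub>R snd (Y \<omega>) \<partial>M)"
      if "exp_growth M Z Y" for Y :: "'w \<Rightarrow> (real ^ 'd) \<times> (real ^ 'p)"
      using integral_bounded_linear[OF bounded_linear_fst int[OF that]]
        integral_bounded_linear[OF bounded_linear_snd int[OF that]] by simp_all
    show "GDERIV (\<lambda>t. v (t, lam)) \<theta> :> (\<integral>\<omega>. ?E \<omega> *\<^sub>R (\<theta> - G \<omega>) \<partial>M)"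
      using grad_t[OF x] unfolding g_def fst_int[OF exp_growth_score] by (simp add: score_def)
    show "GDERIV (\<lambda>l. v (\<theta>, l)) lam :> (\<integral>\<omega>. ?E \<omega> *\<^sub>R a_vec (N \<omega>) lam \<partial>M)"
      using grad_l[OF x] unfolding g_def snd_int[OF exp_growth_score] by (simp add: score_def)

    have grow_H: "exp_growth M Z (\<lambda>\<omega>. score_deriv (\<theta>, lam) \<omega> h + (score (\<theta>, lam) \<omega> \<bullet> h) *\<^sub>R score (\<theta>, lam) \<omega>)" for h
      by (intro exp_growth_add exp_growth_scaleR exp_growth_score exp_growth_score_inner exp_growth_score_deriv)
    \<comment> \<open>The blocks of the Hessian are its values on directions of the form \<open>(h, 0)\<close> and \<open>(0, h)\<close>.\<close>
    have H_t: "fst (H (\<theta>, lam) (h, 0)) = (\<integral>\<omega>. ?E \<omega> *\<^sub>R (mat 1 + outer (\<theta> - G \<omega>) (\<theta> - G \<omega>)) \<partial>M) *v h" for h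
      unfolding H_def fst_int[OF grow_H] integral_tilt_matrix_vector[OF W x grow_tt]
      by (simp add: score_def score_deriv_def matrix_vector_mult_add_rdistrib outer_mult_vector)
    have H_tl: "fst (H (\<theta>, lam) (0, h)) = (\<integral>\<omega>. ?E \<omega> *\<^sub>R outer (\<theta> - G \<omega>) (a_vec (N \<omega>) lam) \<partial>M) *v h" for h
      unfolding H_def fst_int[OF grow_H] integral_tilt_matrix_vector[OF W x grow_tl]
      by (simp add: score_def score_deriv_def outer_mult_vector)
    have H_l: "snd (H (\<theta>, lam) (0, h)) =
        (\<integral>\<omega>. ?E \<omega> *\<^sub>R (D_mat (N \<omega>) lam + outer (a_vec (N \<omega>) lam) (a_vec (N \<omega>) lam)) \<partial>M) *v h" for h
      unfolding H_def snd_int[OF grow_H] integral_tilt_matrix_vector[OF W x grow_ll]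
      by (simp add: score_def score_deriv_def matrix_vector_mult_add_rdistrib outer_mult_vector)

    have g_t: "((\<lambda>t. g (t, lam)) has_derivative (\<lambda>h. H (\<theta>, lam) (h, 0))) (at \<theta>)"
      by (rule has_derivative_compose[where f = "\<lambda>t. (t, lam)", OF _ g_H[OF x]]) (intro derivative_intros)
    have g_l: "((\<lambda>l. g (\<theta>, l)) has_derivative (\<lambda>h. H (\<theta>, lam) (0, h))) (at lam)"
      by (rule has_derivative_compose[where f = "\<lambda>l. (\<theta>, l)", OF _ g_H[OF x]]) (intro derivative_intros)
    have grad_eq_t: "gradient (\<lambda>t'. v (t', lam)) t = fst (g (t, lam))" for t
      using x by (intro gradient_eqI grad_t) (simp add: dom_v_def)
    show "((\<lambda>t. gradient (\<lambda>t'. v (t', lam)) t) has_derivative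
        (*v) (\<integral>\<omega>. ?E \<omega> *\<^sub>R (mat 1 + outer (\<theta> - G \<omega>) (\<theta> - G \<omega>)) \<partial>M)) (at \<theta>)"
      unfolding grad_eq_t using has_derivative_fst[OF g_t] unfolding H_t .
    \<comment> \<open>The gradient formula holds for positive parameters only, an open set around \<open>lam\<close>.\<close>
    let ?L = "{l. (\<theta>, l) \<in> dom_v}"
    have L: "open ?L" "lam \<in> ?L"
      using x open_vimage[OF open_dom_v, of "\<lambda>l. (\<theta>, l)"]
      by (simp_all add: vimage_def continuous_intros)
    show "((\<lambda>l. gradient (\<lambda>t. v (t, l)) \<theta>) has_derivative
        (*v) (\<integral>\<omega>. ?E \<omega> *\<^sub>R outer (\<theta> - G \<omega>) (a_vec (N \<omega>) lam) \<partial>M)) (at lam)"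
      by (rule has_derivative_transform_within_open[OF has_derivative_fst[OF g_l, unfolded H_tl] L])
        (simp add: gradient_eqI[OF grad_t])
    show "((\<lambda>l. gradient (\<lambda>l'. v (\<theta>, l')) l) has_derivative
        (*v) (\<integral>\<omega>. ?E \<omega> *\<^sub>R (D_mat (N \<omega>) lam + outer (a_vec (N \<omega>) lam) (a_vec (N \<omega>) lam)) \<partial>M)) (at lam)"
      by (rule has_derivative_transform_within_open[OF has_derivative_snd[OF g_l, unfolded H_l] L])
        (simp add: gradient_eqI[OF grad_l])
  qed
qed

end
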